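(* Let $a, r \ge 1$ and $b \ge \max\{a, 2r+2\}$ be integers. Let $G$ be a connected graph of order $n \geq (r+1)(b-r)+2a^2+2a(r+2)-1$. If $\lambda(G) \geq \lambda(H_{n}^{a,r})$, where $H_{n}^{a,r}=rK_1\vee \big(K_{a-1}\vee (K_{n-a-r}\cup K_1)\big)$, then $G$ is fractional $ID$-$[a,b]$-factor-critical (with respect to $r$) unless $G \cong H_{n}^{a,r}$.
   Context: All graphs are finite, simple and undirected. $\lambda(G)$ denotes the largest eigenvalue of the adjacency matrix of $G$. $K_m$ is the complete graph on $m$ vertices ($K_0$ is the empty graph), $mK_1$ is the edgeless graph on $m$ vertices, $G_1\cup G_2$ is disjoint union, and the join $G_1\vee G_2$ is obtained from $G_1\cup G_2$ by adding all edges between $V(G_1)$ and $V(G_2)$. For positive integers $a\le b$, a graph $G$ has a fractional $[a,b]$-factor if there is a function $h: E(G)\to[0,1]$ such that $a\le \sum_{e\ni v} h(e)\le b$ for every $v\in V(G)$ (the sum is over edges incident with $v$). For an integer $r\ge 1$, $G$ is fractional $ID$-$[a,b]$-factor-critical (with respect to $r$) if for every independent set $I$ of $G$ with $|I|=r$, the graph $G-I$ has a fractional $[a,b]$-factor. *)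

theory Defs
  imports
    "Graph_Theory.Graph_Theory"
    "Jordan_Normal_Form.Spectral_Radius"
begin

text \<open>
  A finite simple undirected graph is a \<^locale>\<open>graph\<close> of the Graph Theory library: a finite
  symmetric digraph without loops and parallel arcs.  An undirected edge \<open>uv\<close> corresponds to the
  two arcs \<open>(u, v)\<close> and \<open>(v, u)\<close>, hence it is the two-element set of its ends that is an edge.
\<close>

definition edges :: "('a, 'b) pre_digraph \<Rightarrow> 'a set set" where
  "edges G = {{u, v} | u v. u \<rightarrow>\<^bsub>G\<^esub> v}"

definition independent_set :: "('a, 'b) pre_digraph \<Rightarrow> 'a set \<Rightarrow> bool" where
  "independent_set G I \<longleftrightarrow> I \<subseteq> verts G \<and> (\<forall>u\<in>I. \<forall>v\<in>I. \<not> u \<rightarrow>\<^bsub>G\<^esub> v)"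


section \<open>Spectral radius of a graph\<close>

definition adjacency_matrix :: "('a, 'b) pre_digraph \<Rightarrow> 'a list \<Rightarrow> real mat" where
  "adjacency_matrix G vs =
     mat (length vs) (length vs) (\<lambda>(i, j). if vs ! i \<rightarrow>\<^bsub>G\<^esub> vs ! j then 1 else 0)"

text \<open>
  The rows and columns of the adjacency matrix are ordered by an arbitrary enumeration of the
  vertices; the lemma \<open>spectrum_adjacency_matrix\<close> shows that the spectrum does not depend on it.
  As the spectrum is taken over the reals, \<^const>\<open>Max\<close> is the largest real eigenvalue, and it
  exists by \<open>largest_eigenvalue\<close>.
\<close>

definition vertex_enum :: "('a, 'b) pre_digraph \<Rightarrow> 'a list" where
  "vertex_enum G = (SOME vs. distinct vs \<and> set vs = verts G)"

definition largest_eigenvalue :: "('a, 'b) pre_digraph \<Rightarrow> real" (\<open>\<lambda>\<^sub>1\<close>) where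
  "\<lambda>\<^sub>1 G = Max (spectrum (adjacency_matrix G (vertex_enum G)))"

lemma vertex_enum:
  assumes "finite (verts G)"
  shows "distinct (vertex_enum G)" "set (vertex_enum G) = verts G"
proof -
  have "\<exists>vs. distinct vs \<and> set vs = verts G"
    using finite_distinct_list[OF assms] by blast
  then have "distinct (vertex_enum G) \<and> set (vertex_enum G) = verts G"
    unfolding vertex_enum_def by (rule someI_ex)
  then show "distinct (vertex_enum G)" "set (vertex_enum G) = verts G" by auto
qed

lemma adjacency_matrix_carrier:
  "adjacency_matrix G vs \<in> carrier_mat (length vs) (length vs)"
  by (simp add: adjacency_matrix_def)

lemma adjacency_matrix_mult_vec:
  assumes "distinct vs" "i < length vs"
  shows "(adjacency_matrix G vs *\<^sub>v vec (length vs) (\<lambda>j. f (vs ! j))) $ i =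
    (\<Sum>v | v \<in> set vs \<and> vs ! i \<rightarrow>\<^bsub>G\<^esub> v. f v)"
proof -
  have "(adjacency_matrix G vs *\<^sub>v vec (length vs) (\<lambda>j. f (vs ! j))) $ i =
      (\<Sum>j<length vs. (if vs ! i \<rightarrow>\<^bsub>G\<^esub> vs ! j then f (vs ! j) else 0))"
    using assms by (auto simp: adjacency_matrix_def scalar_prod_def lessThan_atLeast0 intro!: sum.cong)
  also have "\<dots> = (\<Sum>v\<in>set vs. if vs ! i \<rightarrow>\<^bsub>G\<^esub> v then f v else 0)"
    by (rule sum.reindex_bij_betw[OF bij_betw_nth[OF assms(1)]]) auto
  also have "\<dots> = (\<Sum>v | v \<in> set vs \<and> vs ! i \<rightarrow>\<^bsub>G\<^esub> v. f v)"
    by (simp add: sum.inter_filter)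
  finally show ?thesis .
qed

lemma eigenvalue_adjacency_matrix:
  assumes "distinct vs"
  shows "eigenvalue (adjacency_matrix G vs) k \<longleftrightarrow>
    (\<exists>f. (\<exists>u\<in>set vs. f u \<noteq> 0) \<and>
         (\<forall>u\<in>set vs. (\<Sum>v | v \<in> set vs \<and> u \<rightarrow>\<^bsub>G\<^esub> v. f v) = k * f u))"
    (is "?L \<longleftrightarrow> ?R")
proof
  let ?A = "adjacency_matrix G vs" and ?n = "length vs"
  assume ?L
  then obtain x where x: "x \<in> carrier_vec ?n" "x \<noteq> 0\<^sub>v ?n" "?A *\<^sub>v x = k \<cdot>\<^sub>v x"
    unfolding eigenvalue_def eigenvector_def by (auto simp: adjacency_matrix_def)
  define f where "f u = x $ (the_inv_into {..<?n} (\<lambda>i. vs ! i) u)" for u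
  have inj: "inj_on (\<lambda>i. vs ! i) {..<?n}"
    using assms by (auto simp: inj_on_def nth_eq_iff_index_eq)
  have f: "f (vs ! i) = x $ i" if "i < ?n" for i
    using that the_inv_into_f_f[OF inj] by (simp add: f_def)
  have xf: "x = vec ?n (\<lambda>j. f (vs ! j))"
    using x(1) by (intro eq_vecI) (auto simp: f)
  have "\<exists>u\<in>set vs. f u \<noteq> 0"
  proof (rule ccontr)
    assume "\<not> ?thesis"
    then have "x = 0\<^sub>v ?n" using x(1) f by (intro eq_vecI) force+
    with x(2) show False by simp
  qed
  moreover have "(\<Sum>v | v \<in> set vs \<and> u \<rightarrow>\<^bsub>G\<^esub> v. f v) = k * f u" if "u \<in> set vs" for u
  proof -
    from that obtain i where i: "i < ?n" "u = vs ! i" by (auto simp: in_set_conv_nth)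
    have "(?A *\<^sub>v x) $ i = k * x $ i" using x i by simp
    then show ?thesis
      using adjacency_matrix_mult_vec[OF assms i(1), of G f] xf f[OF i(1)] i(2) by simp
  qed
  ultimately show ?R by blast
next
  let ?A = "adjacency_matrix G vs" and ?n = "length vs"
  assume ?R
  then obtain f where f: "\<exists>u\<in>set vs. f u \<noteq> 0"
    "\<And>u. u \<in> set vs \<Longrightarrow> (\<Sum>v | v \<in> set vs \<and> u \<rightarrow>\<^bsub>G\<^esub> v. f v) = k * f u" by blast
  let ?x = "vec ?n (\<lambda>j. f (vs ! j))"
  from f(1) obtain i where i: "i < ?n" "f (vs ! i) \<noteq> 0" by (auto simp: in_set_conv_nth)
  then have "?x $ i \<noteq> 0\<^sub>v ?n $ i" by simp
  then have "?x \<noteq> 0\<^sub>v ?n" by metis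
  moreover have "?A *\<^sub>v ?x = k \<cdot>\<^sub>v ?x"
  proof (rule eq_vecI)
    fix j assume "j < dim_vec (k \<cdot>\<^sub>v ?x)"
    then have j: "j < ?n" by simp
    show "(?A *\<^sub>v ?x) $ j = (k \<cdot>\<^sub>v ?x) $ j"
      unfolding adjacency_matrix_mult_vec[OF assms j] using f(2)[of "vs ! j"] j by simp
  qed (simp add: adjacency_matrix_def)
  ultimately show ?L
    unfolding eigenvalue_def eigenvector_def
    by (intro exI[of _ ?x]) (simp add: adjacency_matrix_def)
qed

lemma spectrum_adjacency_matrix:
  assumes "distinct vs" "distinct ws" "set vs = set ws"
  shows "spectrum (adjacency_matrix G vs) = spectrum (adjacency_matrix G ws)"
  unfolding spectrum_def eigenvalue_adjacency_matrix[OF assms(1)]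
    eigenvalue_adjacency_matrix[OF assms(2)] assms(3) ..

lemma symmetric_real_eigenvalue_exists:
  fixes A :: "real mat"
  assumes A: "A \<in> carrier_mat n n" and "n \<noteq> 0"
    and sym: "\<And>i j. i < n \<Longrightarrow> j < n \<Longrightarrow> A $$ (i, j) = A $$ (j, i)"
  shows "spectrum A \<noteq> {}"
proof -
  let ?C = "map_mat complex_of_real A"
  have C: "?C \<in> carrier_mat n n" using A by simp
  from spectrum_non_empty[OF C] \<open>n \<noteq> 0\<close> obtain m where "eigenvalue ?C m"
    by (auto simp: spectrum_def)
  then obtain x where x: "x \<in> carrier_vec n" "x \<noteq> 0\<^sub>v n" "?C *\<^sub>v x = m \<cdot>\<^sub>v x"
    using C unfolding eigenvalue_def eigenvector_def by auto
  have row: "(\<Sum>j<n. of_real (A $$ (i, j)) * x $ j) = m * x $ i" if "i < n" for i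
  proof -
    have "(?C *\<^sub>v x) $ i = m * x $ i" using x that by simp
    then show ?thesis using that A x(1) by (simp add: scalar_prod_def lessThan_atLeast0)
  qed
  define q where "q = (\<Sum>i<n. cnj (x $ i) * (\<Sum>j<n. of_real (A $$ (i, j)) * x $ j))"
  define s where "s = (\<Sum>i<n. (cmod (x $ i))\<^sup>2)"
  have q: "q = m * of_real s"
    unfolding q_def s_def of_real_sum sum_distrib_left[of m]
    by (intro sum.cong refl, unfold lessThan_iff row complex_norm_square) (simp only: mult_ac)
  have "cnj q = (\<Sum>i<n. \<Sum>j<n. cnj (x $ j) * (of_real (A $$ (j, i)) * x $ i))"
    unfolding q_def by (auto simp: sum_distrib_left sym mult_ac intro!: sum.cong)
  also have "\<dots> = q"
    unfolding q_def sum_distrib_left by (rule sum.swap)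
  finally have qr: "cnj q = q" .
  obtain i where i: "i < n" "x $ i \<noteq> 0"
  proof (rule ccontr)
    assume "\<not> thesis"
    with that have "x = 0\<^sub>v n" using x(1) by (intro eq_vecI) auto
    with x(2) show False by simp
  qed
  have "s > 0"
    unfolding s_def by (rule sum_pos2[of _ i]) (use i in auto)
  with q qr have "cnj m = m" by simp
  then have m: "m = of_real (Re m)" by (metis complex_cnj_cancel_iff Reals_cnj_iff of_real_Re)
  have re: "(\<Sum>j<n. A $$ (k, j) * Re (x $ j)) = Re m * Re (x $ k)"
    and im: "(\<Sum>j<n. A $$ (k, j) * Im (x $ j)) = Re m * Im (x $ k)" if "k < n" for k
  proof -
    have "(\<Sum>j<n. of_real (A $$ (k, j)) * x $ j) = of_real (Re m) * x $ k"
      using row[OF that] m by simp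
    from arg_cong[OF this, of Re] arg_cong[OF this, of Im]
    show "(\<Sum>j<n. A $$ (k, j) * Re (x $ j)) = Re m * Re (x $ k)"
      "(\<Sum>j<n. A $$ (k, j) * Im (x $ j)) = Re m * Im (x $ k)" by simp_all
  qed
  have "eigenvalue A (Re m)"
    if "y i \<noteq> 0" "\<And>k. k < n \<Longrightarrow> (\<Sum>j<n. A $$ (k, j) * y j) = Re m * y k" for y
  proof -
    have "vec n y $ i \<noteq> 0\<^sub>v n $ i" using that(1) i by simp
    then have "vec n y \<noteq> 0\<^sub>v n" by metis
    moreover have "A *\<^sub>v vec n y = Re m \<cdot>\<^sub>v vec n y"
      using A that(2) by (intro eq_vecI) (auto simp: scalar_prod_def lessThan_atLeast0)
    ultimately show ?thesis
      using A unfolding eigenvalue_def eigenvector_def by (intro exI[of _ "vec n y"]) simp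
  qed
  from this[of "\<lambda>j. Re (x $ j)"] this[of "\<lambda>j. Im (x $ j)"] re im i(2)
  have "eigenvalue A (Re m)" by (auto simp: complex_eq_iff)
  then show ?thesis by (auto simp: spectrum_def)
qed

lemma largest_eigenvalue:
  assumes "graph G" "verts G \<noteq> {}"
  shows "\<lambda>\<^sub>1 G \<in> spectrum (adjacency_matrix G (vertex_enum G))"
    and "k \<in> spectrum (adjacency_matrix G (vertex_enum G)) \<Longrightarrow> k \<le> \<lambda>\<^sub>1 G"
proof -
  interpret graph G by fact
  let ?A = "adjacency_matrix G (vertex_enum G)" and ?n = "length (vertex_enum G)"
  have ne: "?n \<noteq> 0" using vertex_enum(2)[of G] assms(2) by auto
  have "?A $$ (i, j) = ?A $$ (j, i)" if "i < ?n" "j < ?n" for i j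
    using that sym_arcs by (auto simp: adjacency_matrix_def dest: arcs_ends_symmetric)
  from symmetric_real_eigenvalue_exists[OF adjacency_matrix_carrier ne this]
  have "spectrum ?A \<noteq> {}" by blast
  moreover have "finite (spectrum ?A)"
    by (rule card_finite_spectrum(1)[OF adjacency_matrix_carrier])
  ultimately show "\<lambda>\<^sub>1 G \<in> spectrum ?A" "k \<in> spectrum ?A \<Longrightarrow> k \<le> \<lambda>\<^sub>1 G"
    unfolding largest_eigenvalue_def by auto
qed


section \<open>Complete and edgeless graphs, disjoint union and join\<close>

definition complete_graph :: "nat \<Rightarrow> nat pair_pre_digraph" where
  "complete_graph m = \<lparr> pverts = {..<m}, parcs = {(u, v). u < m \<and> v < m \<and> u \<noteq> v} \<rparr>"

definition edgeless_graph :: "nat \<Rightarrow> nat pair_pre_digraph" where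
  "edgeless_graph m = \<lparr> pverts = {..<m}, parcs = {} \<rparr>"

definition disjoint_union ::
  "'a pair_pre_digraph \<Rightarrow> 'b pair_pre_digraph \<Rightarrow> ('a + 'b) pair_pre_digraph" where
  "disjoint_union G H =
     \<lparr> pverts = pverts G <+> pverts H,
       parcs = map_prod Inl Inl ` parcs G \<union> map_prod Inr Inr ` parcs H \<rparr>"

definition join ::
  "'a pair_pre_digraph \<Rightarrow> 'b pair_pre_digraph \<Rightarrow> ('a + 'b) pair_pre_digraph" where
  "join G H =
     \<lparr> pverts = pverts (disjoint_union G H),
       parcs = parcs (disjoint_union G H)
         \<union> (Inl ` pverts G) \<times> (Inr ` pverts H) \<union> (Inr ` pverts H) \<times> (Inl ` pverts G) \<rparr>"

lemma pair_graph_complete_graph: "pair_graph (complete_graph m)"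
proof -
  have "parcs (complete_graph m) \<subseteq> {..<m} \<times> {..<m}" by (auto simp: complete_graph_def)
  then have "finite (parcs (complete_graph m))" by (rule finite_subset) simp
  then show ?thesis
    by unfold_locales (auto simp: complete_graph_def symmetric_def sym_def)
qed

lemma pair_graph_edgeless_graph: "pair_graph (edgeless_graph m)"
  by unfold_locales (auto simp: edgeless_graph_def symmetric_def sym_def)

lemma pair_graph_disjoint_union:
  assumes "pair_graph G" "pair_graph H"
  shows "pair_graph (disjoint_union G H)"
proof -
  interpret G: pair_graph G by fact
  interpret H: pair_graph H by fact
  show ?thesis
    using G.pair_sym_arcs H.pair_sym_arcs
    by unfold_locales
      (auto simp: disjoint_union_def symmetric_def sym_def
        dest: G.wellformed' H.wellformed' G.pair_no_loops H.pair_no_loops)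
qed

lemma pair_graph_join:
  assumes "pair_graph G" "pair_graph H"
  shows "pair_graph (join G H)"
proof -
  interpret G: pair_graph G by fact
  interpret H: pair_graph H by fact
  interpret GH: pair_graph "disjoint_union G H" by (rule pair_graph_disjoint_union) fact+
  have "symmetric (with_proj (join G H))"
    using GH.pair_sym_arcs unfolding symmetric_def sym_def by (simp add: join_def)
  then show ?thesis
    by unfold_locales
      (auto simp: join_def disjoint_union_def
        dest: G.wellformed' H.wellformed' G.pair_no_loops H.pair_no_loops)
qed

text \<open>
  The natural number subtractions are exact whenever \<open>a \<ge> 1\<close> and \<open>n \<ge> a + r\<close>.
\<close>

definition H_graph :: "nat \<Rightarrow> nat \<Rightarrow> nat \<Rightarrow> (nat + nat + nat + nat) pair_pre_digraph" where
  "H_graph n a r =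
     join (edgeless_graph r)
       (join (complete_graph (a - 1))
         (disjoint_union (complete_graph (n - a - r)) (complete_graph 1)))"

lemma graph_H_graph: "graph (with_proj (H_graph n a r))"
  unfolding H_graph_def
  by (intro pair_graph.pair_graphD_graph pair_graph_join pair_graph_disjoint_union
      pair_graph_edgeless_graph pair_graph_complete_graph)

lemma card_verts_H_graph:
  assumes "a \<ge> 1" "n \<ge> a + r"
  shows "card (verts (with_proj (H_graph n a r))) = n"
  using assms
  by (simp add: H_graph_def join_def disjoint_union_def complete_graph_def edgeless_graph_def
      card_Plus)


section \<open>Fractional factors\<close>

definition has_fractional_factor :: "nat \<Rightarrow> nat \<Rightarrow> ('a, 'b) pre_digraph \<Rightarrow> bool" where
  "has_fractional_factor a b G \<longleftrightarrow>
     (\<exists>h :: 'a set \<Rightarrow> real.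
        (\<forall>e\<in>edges G. 0 \<le> h e \<and> h e \<le> 1) \<and>
        (\<forall>v\<in>verts G. real a \<le> (\<Sum>e | e \<in> edges G \<and> v \<in> e. h e) \<and>
                     (\<Sum>e | e \<in> edges G \<and> v \<in> e. h e) \<le> real b))"

definition fractional_ID_factor_critical ::
  "nat \<Rightarrow> nat \<Rightarrow> nat \<Rightarrow> ('a, 'b) pre_digraph \<Rightarrow> bool" where
  "fractional_ID_factor_critical r a b G \<longleftrightarrow>
     (\<forall>I. independent_set G I \<and> card I = r \<longrightarrow>
        has_fractional_factor a b (G \<restriction> (verts G - I)))"

end

theory Submission
  imports Defs "HOL-Analysis.Function_Topology"
begin

text \<open>
  If \<open>G - I\<close> has no fractional \<open>[a, b]\<close>-factor, there are disjoint \<open>S\<close>, \<open>T\<close> with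
  \<open>b |S| + (\<Sum>v\<in>T. deg v in G - I - S) < a |T|\<close>.  If \<open>S\<close> is empty, some vertex has fewer than \<open>a\<close>
  neighbours in \<open>G - I\<close>, so \<open>G\<close> is a spanning subgraph of \<open>H\<close>, and the positive Perron vector of
  \<open>G\<close> shows that its spectral radius is smaller unless \<open>G\<close> and \<open>H\<close> are isomorphic.  If \<open>S\<close> is not empty, then
  \<open>|T| > |S|\<close>, and \<open>G\<close> lacks so many edges at \<open>T\<close> that Hong's bound \<open>\<lambda>\<^sup>2 \<le> 2 e - n + 1\<close>
  contradicts the bound \<open>n - 2 - r (r - 1) / (n - 1)\<close> from below for \<open>H\<close>.
\<close>


section \<open>The Rayleigh quotient of the adjacency matrix\<close>

text \<open>By Tychonoff the box is compact in the product topology, whatever the index type.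
  Coordinates without influence can be frozen by equal bounds.\<close>

lemma ex_minimizer_box:
  fixes lo hi :: "'a \<Rightarrow> real" and F :: "('a \<Rightarrow> real) \<Rightarrow> real"
  assumes le: "\<And>i. lo i \<le> hi i" and cont: "continuous_on UNIV F"
  shows "\<exists>x. (\<forall>i. lo i \<le> x i \<and> x i \<le> hi i) \<and>
    (\<forall>y. (\<forall>i. lo i \<le> y i \<and> y i \<le> hi i) \<longrightarrow> F x \<le> F y)"
proof -
  let ?B = "PiE UNIV (\<lambda>i. {lo i..hi i})"
  have "compactin (product_topology (\<lambda>i::'a. euclidean) UNIV) ?B"
    by (subst compactin_PiE) auto
  then have "compact ?B" by (simp add: euclidean_product_topology)
  moreover have "?B \<noteq> {}" using le by (auto simp: PiE_eq_empty_iff)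
  moreover have "continuous_on ?B F" using cont by (rule continuous_on_subset) simp
  ultimately have "\<exists>x\<in>?B. \<forall>y\<in>?B. F x \<le> F y" by (rule continuous_attains_inf)
  then show ?thesis by (auto simp: PiE_iff Bex_def Ball_def)
qed

lemma finite_ex_max:
  fixes f :: "'a \<Rightarrow> real"
  assumes "finite V" "V \<noteq> {}"
  shows "\<exists>w\<in>V. \<forall>v\<in>V. f v \<le> f w"
proof -
  have "Max (f ` V) \<in> f ` V" using assms by simp
  then obtain w where "w \<in> V" "f w = Max (f ` V)" by auto
  then show ?thesis using Max_ge[of "f ` V"] assms(1) by (metis finite_imageI imageI)
qed

text \<open>The form f^T A f of the 0/1 matrix A of \<open>R\<close>. Functions on a set in place of
  vectors avoid any enumeration of the vertices.\<close>

definition quad_form :: "'a set \<Rightarrow> ('a \<Rightarrow> 'a \<Rightarrow> bool) \<Rightarrow> ('a \<Rightarrow> real) \<Rightarrow> real" where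
  "quad_form V R f = (\<Sum>u\<in>V. f u * (\<Sum>v | v \<in> V \<and> R u v. f v))"

lemma sum_filter_of_bool:
  fixes f :: "'a \<Rightarrow> real"
  assumes "finite V"
  shows "(\<Sum>v | v \<in> V \<and> P v. f v) = (\<Sum>v\<in>V. of_bool (P v) * f v)"
  unfolding sum.inter_filter[OF assms] by (intro sum.cong) auto

lemma quad_form_double_sum:
  "finite V \<Longrightarrow> quad_form V R f = (\<Sum>u\<in>V. \<Sum>v\<in>V. of_bool (R u v) * (f u * f v))"
  unfolding quad_form_def sum_filter_of_bool sum_distrib_left
  by (intro sum.cong refl) (simp only: mult_ac)

lemma quad_form_scale: "quad_form V R (\<lambda>u. c * f u) = c\<^sup>2 * quad_form V R f"
  by (simp add: quad_form_def power2_eq_square mult_ac sum_distrib_left)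

lemma quad_form_cong:
  "(\<And>u. u \<in> V \<Longrightarrow> f u = g u) \<Longrightarrow> quad_form V R f = quad_form V R g"
  by (auto simp: quad_form_def intro!: sum.cong arg_cong2[where f = "(*)"])

text \<open>
  Vectors are normalised in the maximum norm, so that the Rayleigh quotient is maximised over
  finitely many boxes on which its denominator is at least one.
\<close>

lemma ex_maximizer_quad_form:
  assumes fin: "finite V" and ne: "V \<noteq> {}"
  shows "\<exists>m f. (\<exists>u\<in>V. f u \<noteq> 0) \<and> quad_form V R f = m * (\<Sum>u\<in>V. (f u)\<^sup>2) \<and>
    (\<forall>g. quad_form V R g \<le> m * (\<Sum>u\<in>V. (g u)\<^sup>2))"
proof -
  define N where "N g = (\<Sum>u\<in>V. (g u)\<^sup>2)" for g :: "'a \<Rightarrow> real"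
  define Q where "Q = quad_form V R"
  \<comment> \<open>A box: the entry at \<open>w\<close> has largest modulus and is scaled to 1,
    sign included; coordinates outside \<open>V\<close> are frozen at 0.\<close>
  define B where "B w = {g. g w = 1 \<and> (\<forall>u. \<bar>g u\<bar> \<le> 1) \<and> (\<forall>u. u \<notin> V \<longrightarrow> g u = (0::real))}" for w
  have N1: "N g \<ge> 1" if "g \<in> B w" "w \<in> V" for g w
    using member_le_sum[of w V "\<lambda>u. (g u)\<^sup>2"] that fin by (simp add: N_def B_def)
  have "\<exists>x. x \<in> B w \<and> (\<forall>y\<in>B w. Q y / N y \<le> Q x / N x)" if w: "w \<in> V" for w
  proof -
    define lo hi :: "'a \<Rightarrow> real"
      where "lo u = (if u = w then 1 else if u \<in> V then - 1 else 0)"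
        and "hi u = (if u \<in> V then 1 else 0)" for u
    have box: "(\<forall>u. lo u \<le> x u \<and> x u \<le> hi u) \<longleftrightarrow> x \<in> B w" for x
    proof
      assume *: "\<forall>u. lo u \<le> x u \<and> x u \<le> hi u"
      have "\<bar>x u\<bar> \<le> 1 \<and> (u = w \<longrightarrow> x u = 1) \<and> (u \<notin> V \<longrightarrow> x u = 0)" for u
        using spec[OF *, of u] w by (auto simp: lo_def hi_def split: if_splits)
      then show "x \<in> B w" by (simp add: B_def)
    next
      assume "x \<in> B w"
      then have "x w = 1" "\<bar>x u\<bar> \<le> 1" "u \<notin> V \<Longrightarrow> x u = 0" for u by (auto simp: B_def)
      then show "\<forall>u. lo u \<le> x u \<and> x u \<le> hi u" using w by (auto simp: lo_def hi_def abs_le_iff minus_le_iff)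
    qed
    \<comment> \<open>The denominator \<open>max 1 (N g)\<close> keeps the quotient continuous on
      all functions; on \<open>B w\<close> it equals \<open>N g\<close> by
      \<open>N1\<close>.\<close>
    have "continuous_on UNIV (\<lambda>g. - (Q g / max 1 (N g)))"
      unfolding Q_def N_def quad_form_def
      by (intro continuous_intros) (auto intro!: continuous_on_product_coordinates)
    moreover have "lo u \<le> hi u" for u using w by (auto simp: lo_def hi_def)
    ultimately have "\<exists>x. (\<forall>u. lo u \<le> x u \<and> x u \<le> hi u) \<and> (\<forall>y. (\<forall>u. lo u \<le> y u \<and> y u \<le> hi u) \<longrightarrow>
        - (Q x / max 1 (N x)) \<le> - (Q y / max 1 (N y)))" by (intro ex_minimizer_box)
    then obtain x where x: "x \<in> B w" "\<And>y. y \<in> B w \<Longrightarrow> Q y / max 1 (N y) \<le> Q x / max 1 (N x)"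
      unfolding box neg_le_iff_le by blast
    then show ?thesis using N1[OF _ w] by (intro exI[of _ x]) (auto simp: max_absorb2)
  qed
  then obtain x where x: "\<And>w. w \<in> V \<Longrightarrow> x w \<in> B w"
    "\<And>w y. w \<in> V \<Longrightarrow> y \<in> B w \<Longrightarrow> Q y / N y \<le> Q (x w) / N (x w)" by metis
  let ?q = "\<lambda>w. Q (x w) / N (x w)"
  obtain w where w: "w \<in> V" "\<And>v. v \<in> V \<Longrightarrow> ?q v \<le> ?q w"
    using finite_ex_max[OF fin ne, of ?q] by blast
  have "Q g \<le> ?q w * N g" for g
  proof (cases "\<exists>u\<in>V. g u \<noteq> 0")
    case False
    then show ?thesis by (simp add: Q_def N_def quad_form_def)
  next
    case True
    obtain v where v: "v \<in> V" "\<And>u. u \<in> V \<Longrightarrow> \<bar>g u\<bar> \<le> \<bar>g v\<bar>"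
      using finite_ex_max[OF fin ne, of "\<lambda>u. \<bar>g u\<bar>"] by blast
    with True have gv: "g v \<noteq> 0" by fastforce
    \<comment> \<open>Division by the entry of largest modulus leads into \<open>B v\<close> and
      leaves the Rayleigh quotient unchanged.\<close>
    define g' where "g' u = (if u \<in> V then g u / g v else 0)" for u
    have g': "g' \<in> B v" using v gv by (auto simp: g'_def B_def)
    have g: "g u = g v * g' u" if "u \<in> V" for u using that gv by (simp add: g'_def)
    have "Q g = (g v)\<^sup>2 * Q g'"
      unfolding Q_def by (subst quad_form_scale[symmetric], rule quad_form_cong) (rule g)
    moreover have "N g = (g v)\<^sup>2 * N g'"
      unfolding N_def sum_distrib_left by (intro sum.cong) (auto simp: g power_mult_distrib)
    moreover have "Q g' / N g' \<le> ?q w" using x(2)[OF v(1) g'] w(2)[OF v(1)] by (rule order_trans)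
    then have "Q g' \<le> ?q w * N g'"
      by (subst (asm) pos_divide_le_eq) (use N1[OF g' v(1)] in auto)
    ultimately show ?thesis by (metis mult.left_commute mult_left_mono zero_le_power2)
  qed
  moreover have "x w w \<noteq> 0" using x(1)[OF w(1)] by (simp add: B_def)
  moreover have "Q (x w) = ?q w * N (x w)" using N1[OF x(1) w(1)] w(1) by auto
  ultimately show ?thesis unfolding Q_def N_def using w(1) by blast
qed

text \<open>First-order optimality without derivatives: near 0 the linear term dominates, so it
  would take negative values unless it vanishes.\<close>

lemma zero_if_quadratic_nonneg:
  fixes b K :: real
  assumes "\<And>e. 0 \<le> 2 * e * b + e\<^sup>2 * K"
  shows "b = 0"
proof (rule ccontr)
  assume b: "b \<noteq> 0"
  define k where "k = \<bar>K\<bar> + 1"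
  have k: "k > 0" "K \<le> k" by (auto simp: k_def)
  \<comment> \<open>\<open>- b / k\<close> is the minimum point once \<open>K\<close> is replaced by
    its positive upper bound \<open>k\<close>.\<close>
  have "0 \<le> 2 * (- b / k) * b + (- b / k)\<^sup>2 * K" by (rule assms)
  also have "\<dots> \<le> 2 * (- b / k) * b + (- b / k)\<^sup>2 * k" using k by (intro add_left_mono mult_left_mono) auto
  also have "\<dots> = - (b\<^sup>2 / k)" using k by (simp add: field_simps power2_eq_square)
  finally show False using b k by (simp add: field_simps)
qed

text \<open>Changing \<open>f\<close> by \<open>e\<close> at \<open>u\<close> alone must keep the
  gap between the two sides of \<open>le\<close> nonnegative. By symmetry, row and column of
  \<open>u\<close> contribute equally, so half the linear coefficient of this gap in
  \<open>e\<close> is the defect of the eigenvalue equation at \<open>u\<close>.\<close>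

lemma quad_form_maximizer_eigenvector:
  assumes fin: "finite V" and sym: "\<And>u v. u \<in> V \<Longrightarrow> v \<in> V \<Longrightarrow> R u v \<Longrightarrow> R v u"
    and le: "\<And>g. quad_form V R g \<le> m * (\<Sum>u\<in>V. (g u)\<^sup>2)"
    and eq: "quad_form V R f = m * (\<Sum>u\<in>V. (f u)\<^sup>2)"
    and u: "u \<in> V"
  shows "(\<Sum>v | v \<in> V \<and> R u v. f v) = m * f u"
proof -
  let ?c = "\<lambda>x y. of_bool (R x y) :: real"
  let ?A = "\<Sum>v | v \<in> V \<and> R u v. f v"
  have A: "(\<Sum>y\<in>V. ?c u y * f y) = ?A" using fin by (simp only: sum_filter_of_bool)
  have A': "(\<Sum>x\<in>V. ?c x u * f x) = ?A"
    unfolding A[symmetric] using sym u by (intro sum.cong) auto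
  have pick: "(\<Sum>x\<in>V. of_bool (x = u) * h x) = h u" for h :: "'a \<Rightarrow> real"
  proof -
    have "(\<Sum>x\<in>V. of_bool (x = u) * h x) = (\<Sum>x\<in>V. if x = u then h x else 0)"
      by (intro sum.cong) auto
    then show ?thesis using fin u by simp
  qed
  have "0 \<le> 2 * e * (m * f u - ?A) + e\<^sup>2 * (m - ?c u u)" for e
  proof -
    let ?g = "\<lambda>x. f x + e * of_bool (x = u)"
    have "quad_form V R ?g = (\<Sum>x\<in>V. \<Sum>y\<in>V. ?c x y * (f x * f y)
        + of_bool (x = u) * (e * (?c x y * f y)) + of_bool (y = u) * (e * (?c x y * f x))
        + of_bool (x = u) * (of_bool (y = u) * (e\<^sup>2 * ?c x y)))"
      unfolding quad_form_double_sum[OF fin]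
      by (intro sum.cong refl) (simp add: algebra_simps power2_eq_square)
    also have "\<dots> = quad_form V R f + e * ?A + e * ?A + e\<^sup>2 * ?c u u"
      unfolding sum.distrib quad_form_double_sum[OF fin]
      by (simp only: pick A A' flip: sum_distrib_left)
    finally have Q: "quad_form V R ?g = quad_form V R f + 2 * e * ?A + e\<^sup>2 * ?c u u" by simp
    have "(\<Sum>x\<in>V. (?g x)\<^sup>2) =
        (\<Sum>x\<in>V. (f x)\<^sup>2 + (if x = u then 2 * e * f x + e\<^sup>2 else 0))"
      by (intro sum.cong) (auto simp: power2_eq_square algebra_simps)
    also have "\<dots> = (\<Sum>x\<in>V. (f x)\<^sup>2) + 2 * e * f u + e\<^sup>2"
      using fin u by (simp add: sum.distrib)
    finally show ?thesis using le[of ?g] eq unfolding Q by (simp add: algebra_simps)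
  qed
  then have "m * f u - ?A = 0" by (rule zero_if_quadratic_nonneg)
  then show ?thesis by simp
qed

section \<open>Neighbourhoods, the variational principle and the Perron vector of a graph\<close>

definition nbrs :: "('a, 'b) pre_digraph \<Rightarrow> 'a \<Rightarrow> 'a set" where
  "nbrs G u = {v \<in> verts G. u \<rightarrow>\<^bsub>G\<^esub> v}"

lemma (in graph) finite_nbrs: "finite (nbrs G u)"
  by (simp add: nbrs_def)

lemma (in graph) dominates_sym: "u \<rightarrow>\<^bsub>G\<^esub> v \<Longrightarrow> v \<rightarrow>\<^bsub>G\<^esub> u"
  using sym_arcs by (auto dest: arcs_ends_symmetric)

lemma (in graph) dominates_neq: "u \<rightarrow>\<^bsub>G\<^esub> v \<Longrightarrow> u \<noteq> v"
  using no_loops by (auto simp: arcs_ends_conv)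

lemma (in graph) dominates_verts: "u \<rightarrow>\<^bsub>G\<^esub> v \<Longrightarrow> u \<in> verts G \<and> v \<in> verts G"
  by auto

abbreviation adj_form :: "('a, 'b) pre_digraph \<Rightarrow> ('a \<Rightarrow> real) \<Rightarrow> real" where
  "adj_form G \<equiv> quad_form (verts G) (\<lambda>u v. u \<rightarrow>\<^bsub>G\<^esub> v)"

lemma mem_spectrum_iff:
  assumes "finite (verts G)"
  shows "k \<in> spectrum (adjacency_matrix G (vertex_enum G)) \<longleftrightarrow>
    (\<exists>f. (\<exists>u\<in>verts G. f u \<noteq> 0) \<and> (\<forall>u\<in>verts G. (\<Sum>v\<in>nbrs G u. f v) = k * f u))"
  by (simp add: spectrum_def nbrs_def eigenvalue_adjacency_matrix[OF vertex_enum(1)[OF assms]]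
      vertex_enum(2)[OF assms])

text \<open>The maximal quotient is an eigenvalue because a maximiser is an eigenvector; conversely,
  an eigenvector for the largest eigenvalue has that eigenvalue as its quotient. So the two numbers
  agree.\<close>

lemma rayleigh_largest_eigenvalue:
  assumes G: "graph G" and ne: "verts G \<noteq> {}"
  shows "\<exists>f. (\<exists>u\<in>verts G. f u \<noteq> 0) \<and> adj_form G f = \<lambda>\<^sub>1 G * (\<Sum>u\<in>verts G. (f u)\<^sup>2)"
    and "adj_form G g \<le> \<lambda>\<^sub>1 G * (\<Sum>u\<in>verts G. (g u)\<^sup>2)"
proof -
  interpret graph G by fact
  let ?V = "verts G"
  obtain m f where f: "\<exists>u\<in>?V. f u \<noteq> 0" "adj_form G f = m * (\<Sum>u\<in>?V. (f u)\<^sup>2)"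
    and le: "\<And>g. adj_form G g \<le> m * (\<Sum>u\<in>?V. (g u)\<^sup>2)"
    using ex_maximizer_quad_form[of ?V "\<lambda>u v. u \<rightarrow>\<^bsub>G\<^esub> v"] ne by auto
  have "(\<Sum>v\<in>nbrs G u. f v) = m * f u" if "u \<in> ?V" for u
    unfolding nbrs_def
    using quad_form_maximizer_eigenvector[OF _ dominates_sym le f(2) that] by simp
  with f(1) have "m \<in> spectrum (adjacency_matrix G (vertex_enum G))"
    unfolding mem_spectrum_iff[OF finite_verts] by blast
  then have m: "m \<le> \<lambda>\<^sub>1 G" by (rule largest_eigenvalue(2)[OF G ne])
  obtain h where h: "\<exists>u\<in>?V. h u \<noteq> 0" "\<And>u. u \<in> ?V \<Longrightarrow> (\<Sum>v\<in>nbrs G u. h v) = \<lambda>\<^sub>1 G * h u"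
    using largest_eigenvalue(1)[OF G ne] unfolding mem_spectrum_iff[OF finite_verts] by blast
  have "adj_form G h = (\<Sum>u\<in>?V. h u * (\<lambda>\<^sub>1 G * h u))"
    unfolding quad_form_def using h(2) by (intro sum.cong) (simp_all add: nbrs_def)
  also have "\<dots> = \<lambda>\<^sub>1 G * (\<Sum>u\<in>?V. (h u)\<^sup>2)"
    by (simp add: sum_distrib_left power2_eq_square mult_ac)
  finally have "\<lambda>\<^sub>1 G * (\<Sum>u\<in>?V. (h u)\<^sup>2) \<le> m * (\<Sum>u\<in>?V. (h u)\<^sup>2)" using le[of h] by simp
  moreover obtain u where "u \<in> ?V" "h u \<noteq> 0" using h(1) by blast
  then have "(\<Sum>u\<in>?V. (h u)\<^sup>2) > 0" by (intro sum_pos2[of _ u]) auto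
  ultimately have "\<lambda>\<^sub>1 G \<le> m" by simp
  with m have "m = \<lambda>\<^sub>1 G" by simp
  with f le show "\<exists>f. (\<exists>u\<in>?V. f u \<noteq> 0) \<and> adj_form G f = \<lambda>\<^sub>1 G * (\<Sum>u\<in>?V. (f u)\<^sup>2)"
    and "adj_form G g \<le> \<lambda>\<^sub>1 G * (\<Sum>u\<in>?V. (g u)\<^sup>2)" by blast+
qed

text \<open>Connectedness speaks of reachability in \<open>mk_symmetric G\<close>, which for
  symmetric arcs is reachability in \<open>G\<close>; then induction along a walk from
  \<open>u\<close>.\<close>

lemma connected_closed_set:
  assumes con: "Digraph_Component.connected G" and G: "graph G"
    and u: "u \<in> verts G" "u \<in> X" and step: "\<And>x y. x \<in> X \<Longrightarrow> x \<rightarrow>\<^bsub>G\<^esub> y \<Longrightarrow> y \<in> X"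
  shows "verts G \<subseteq> X"
proof
  interpret graph G by fact
  fix v assume v: "v \<in> verts G"
  have "u \<rightarrow>\<^sup>*\<^bsub>with_proj (mk_symmetric G)\<^esub> v"
    using con u(1) v by (auto simp: connected_def strongly_connected_def)
  then have "u \<rightarrow>\<^sup>*\<^bsub>G\<^esub> v" by (simp add: reachable_mk_symmetric_eq sym_arcs)
  then show "v \<in> X" by (induction rule: reachable_induct) (use u step in auto)
qed

text \<open>Absolute values do not decrease the form and keep the norm, so they turn a maximiser
  into a nonnegative one, again an eigenvector. By the eigenvalue equation at \<open>y\<close>, a
  nonzero entry at a neighbour of \<open>y\<close> forces one at \<open>y\<close>; connectedness
  spreads this to all vertices.\<close>

lemma perron_vector:
  assumes G: "graph G" and con: "Digraph_Component.connected G" and ne: "verts G \<noteq> {}"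
  shows "\<exists>f. (\<forall>u\<in>verts G. f u > 0) \<and> adj_form G f = \<lambda>\<^sub>1 G * (\<Sum>u\<in>verts G. (f u)\<^sup>2)"
proof -
  interpret graph G by fact
  let ?V = "verts G"
  obtain f where f: "\<exists>u\<in>?V. f u \<noteq> 0" "adj_form G f = \<lambda>\<^sub>1 G * (\<Sum>u\<in>?V. (f u)\<^sup>2)"
    using rayleigh_largest_eigenvalue(1)[OF G ne] by blast
  let ?g = "\<lambda>u. \<bar>f u\<bar>"
  have "adj_form G f \<le> adj_form G ?g"
    unfolding quad_form_double_sum[OF finite_verts]
    by (intro sum_mono mult_left_mono) (auto simp flip: abs_mult)
  then have g: "adj_form G ?g = \<lambda>\<^sub>1 G * (\<Sum>u\<in>?V. (?g u)\<^sup>2)"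
    using rayleigh_largest_eigenvalue(2)[OF G ne, of ?g] f(2) by simp
  have eig: "(\<Sum>v\<in>nbrs G u. ?g v) = \<lambda>\<^sub>1 G * ?g u" if "u \<in> ?V" for u
    unfolding nbrs_def
    by (rule quad_form_maximizer_eigenvector[OF finite_verts dominates_sym _ g that])
      (auto intro: rayleigh_largest_eigenvalue(2)[OF G ne])
  obtain u where u: "u \<in> ?V" "f u \<noteq> 0" using f(1) by blast
  have "?V \<subseteq> {u. f u \<noteq> 0}"
  proof (rule connected_closed_set[OF con G u(1)])
    fix x y assume x: "x \<in> {u. f u \<noteq> 0}" and xy: "x \<rightarrow>\<^bsub>G\<^esub> y"
    have "0 < (\<Sum>v\<in>nbrs G y. ?g v)"
      by (rule sum_pos2[of _ x]) (use x xy dominates_sym finite_nbrs in \<open>auto simp: nbrs_def\<close>)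
    also have "\<dots> = \<lambda>\<^sub>1 G * ?g y" using xy by (intro eig) auto
    finally show "y \<in> {u. f u \<noteq> 0}" by auto
  qed (use u in simp)
  with g show ?thesis by (intro exI[of _ ?g]) auto
qed


section \<open>Comparison of spectral radii\<close>

text \<open>The positive Perron vector of \<open>G\<close>, transported along \<open>\<phi>\<close>,
  is a test vector for \<open>H\<close>: no arc loses its contribution, and the new arc adds a
  positive one.\<close>

lemma largest_eigenvalue_less:
  assumes G: "graph G" "Digraph_Component.connected G" "verts G \<noteq> {}" and H: "graph H"
    and bij: "bij_betw \<phi> (verts G) (verts H)"
    and hom: "\<And>u v. u \<rightarrow>\<^bsub>G\<^esub> v \<Longrightarrow> \<phi> u \<rightarrow>\<^bsub>H\<^esub> \<phi> v"
    and xy: "x \<in> verts G" "y \<in> verts G" "\<phi> x \<rightarrow>\<^bsub>H\<^esub> \<phi> y" "\<not> x \<rightarrow>\<^bsub>G\<^esub> y"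
  shows "\<lambda>\<^sub>1 G < \<lambda>\<^sub>1 H"
proof -
  interpret G: graph G by fact
  interpret H: graph H by fact
  let ?V = "verts G"
  obtain f where f: "\<And>u. u \<in> ?V \<Longrightarrow> f u > 0" "adj_form G f = \<lambda>\<^sub>1 G * (\<Sum>u\<in>?V. (f u)\<^sup>2)"
    using perron_vector[OF G] by blast
  define g where "g w = f (the_inv_into ?V \<phi> w)" for w
  have g: "g (\<phi> u) = f u" if "u \<in> ?V" for u
    using that bij by (simp add: g_def bij_betw_def the_inv_into_f_f)
  have le: "of_bool (u \<rightarrow>\<^bsub>G\<^esub> v) * (f u * f v) \<le> of_bool (\<phi> u \<rightarrow>\<^bsub>H\<^esub> \<phi> v) * (f u * f v)"
    if "u \<in> ?V" "v \<in> ?V" for u v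
    using hom[of u v] f(1)[OF that(1)] f(1)[OF that(2)] by simp
  have "adj_form G f < (\<Sum>u\<in>?V. \<Sum>v\<in>?V. of_bool (\<phi> u \<rightarrow>\<^bsub>H\<^esub> \<phi> v) * (f u * f v))"
    unfolding quad_form_double_sum[OF G.finite_verts]
  proof (rule sum_strict_mono_ex1)
    show "\<exists>u\<in>?V. (\<Sum>v\<in>?V. of_bool (u \<rightarrow>\<^bsub>G\<^esub> v) * (f u * f v))
        < (\<Sum>v\<in>?V. of_bool (\<phi> u \<rightarrow>\<^bsub>H\<^esub> \<phi> v) * (f u * f v))"
      by (rule bexI[OF _ xy(1)], rule sum_strict_mono_ex1) (use le xy f(1) in auto)
    show "\<forall>u\<in>?V. (\<Sum>v\<in>?V. of_bool (u \<rightarrow>\<^bsub>G\<^esub> v) * (f u * f v))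
        \<le> (\<Sum>v\<in>?V. of_bool (\<phi> u \<rightarrow>\<^bsub>H\<^esub> \<phi> v) * (f u * f v))"
      by (intro ballI sum_mono le)
  qed simp
  also have "\<dots> = (\<Sum>u\<in>?V. \<Sum>v\<in>?V. of_bool (\<phi> u \<rightarrow>\<^bsub>H\<^esub> \<phi> v) * (g (\<phi> u) * g (\<phi> v)))"
    by (intro sum.cong) (simp_all add: g)
  also have "\<dots> = adj_form H g"
    unfolding quad_form_double_sum[OF H.finite_verts]
    by (simp only: sum.reindex_bij_betw[OF bij, of "\<lambda>v. of_bool (_ \<rightarrow>\<^bsub>H\<^esub> v) * (_ * g v)"]
        sum.reindex_bij_betw[OF bij, of "\<lambda>u. \<Sum>v\<in>verts H. of_bool (u \<rightarrow>\<^bsub>H\<^esub> v) * (g u * g v)"])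
  also have "\<dots> \<le> \<lambda>\<^sub>1 H * (\<Sum>w\<in>verts H. (g w)\<^sup>2)"
    using H.dominates_verts[OF xy(3)] by (intro rayleigh_largest_eigenvalue(2)[OF H]) auto
  also have "(\<Sum>w\<in>verts H. (g w)\<^sup>2) = (\<Sum>u\<in>?V. (f u)\<^sup>2)"
    unfolding sum.reindex_bij_betw[OF bij, symmetric] by (intro sum.cong) (simp_all add: g)
  finally have "\<lambda>\<^sub>1 G * (\<Sum>u\<in>?V. (f u)\<^sup>2) < \<lambda>\<^sub>1 H * (\<Sum>u\<in>?V. (f u)\<^sup>2)" using f(2) by simp
  moreover have "(\<Sum>u\<in>?V. (f u)\<^sup>2) \<ge> 0" by (simp add: sum_nonneg)
  ultimately show ?thesis by (rule mult_right_less_imp_less)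
qed

text \<open>An isomorphism of digraphs also maps arcs; here an arc goes to the pair of images of its
  ends. This is injective since \<open>G\<close> has no parallel arcs.\<close>

lemma digraph_iso_with_projI:
  assumes G: "graph G" and H: "graph (with_proj H)"
    and bij: "bij_betw \<phi> (verts G) (pverts H)"
    and adj: "\<And>u v. u \<in> verts G \<Longrightarrow> v \<in> verts G \<Longrightarrow> u \<rightarrow>\<^bsub>G\<^esub> v \<longleftrightarrow> (\<phi> u, \<phi> v) \<in> parcs H"
  shows "digraph_iso G (with_proj H)"
proof -
  interpret G: graph G by fact
  interpret H: graph "with_proj H" by fact
  let ?hom = "\<lparr> iso_verts = \<phi>, iso_arcs = \<lambda>e. (\<phi> (tail G e), \<phi> (head G e)),
    iso_head = snd, iso_tail = fst \<rparr>"
  have inj: "inj_on \<phi> (verts G)" and img: "\<phi> ` verts G = pverts H"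
    using bij by (auto simp: bij_betw_def)
  have "inj_on (\<lambda>e. (\<phi> (tail G e), \<phi> (head G e))) (arcs G)"
  proof (rule inj_onI)
    fix e e' assume e: "e \<in> arcs G" "e' \<in> arcs G"
      and "(\<phi> (tail G e), \<phi> (head G e)) = (\<phi> (tail G e'), \<phi> (head G e'))"
    then have "tail G e = tail G e'" "head G e = head G e'" using inj by (auto simp: inj_on_eq_iff)
    with e show "e = e'" by (intro G.no_multi_arcs) (auto simp: arc_to_ends_def)
  qed
  then have "pre_digraph.digraph_isomorphism G ?hom"
    using inj G.wf_digraph_axioms by (simp add: pre_digraph.digraph_isomorphism_def)
  moreover have "parcs H = (\<lambda>e. (\<phi> (tail G e), \<phi> (head G e))) ` arcs G"
  proof (intro equalityI subsetI)
    fix p assume p: "p \<in> parcs H"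
    then have "fst p \<in> \<phi> ` verts G" "snd p \<in> \<phi> ` verts G"
      using H.head_in_verts[of p] H.tail_in_verts[of p] img by auto
    then obtain u v where uv: "p = (\<phi> u, \<phi> v)" "u \<in> verts G" "v \<in> verts G"
      by (metis imageE prod.collapse)
    then have "u \<rightarrow>\<^bsub>G\<^esub> v" using p adj by simp
    with uv(1) show "p \<in> (\<lambda>e. (\<phi> (tail G e), \<phi> (head G e))) ` arcs G"
      by (auto simp: arcs_ends_conv)
  next
    fix p assume "p \<in> (\<lambda>e. (\<phi> (tail G e), \<phi> (head G e))) ` arcs G"
    then obtain e where e: "e \<in> arcs G" "p = (\<phi> (tail G e), \<phi> (head G e))" by blast
    then have "tail G e \<rightarrow>\<^bsub>G\<^esub> head G e" by (auto simp: arcs_ends_conv)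
    with e adj show "p \<in> parcs H" by auto
  qed
  then have "with_proj H = app_iso ?hom G"
    using img by (simp add: app_iso_def with_proj_def)
  ultimately show ?thesis unfolding digraph_iso_def by blast
qed

text \<open>An isolated vertex would form a closed set by itself. This provides the degree condition
  of Hong's bound.\<close>

lemma (in graph) nbrs_nonempty_if_connected:
  assumes con: "Digraph_Component.connected G" and card: "card (verts G) \<ge> 2" and u: "u \<in> verts G"
  shows "nbrs G u \<noteq> {}"
proof
  assume e: "nbrs G u = {}"
  have "verts G \<subseteq> {u}"
    by (rule connected_closed_set[OF con graph_axioms u])
      (use e dominates_verts in \<open>auto simp: nbrs_def\<close>)
  from card_mono[OF _ this] card show False by simp
qed

text \<open>
  Hong's bound: the entry sum of the row of \<open>u\<close> in the squared adjacency matrix is the sum of the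
  degrees of the neighbours of \<open>u\<close>, and every other vertex still has degree at least one.
\<close>

lemma largest_eigenvalue_squared_le:
  assumes G: "graph G" and ne: "verts G \<noteq> {}" and deg: "\<And>u. u \<in> verts G \<Longrightarrow> nbrs G u \<noteq> {}"
  shows "(\<lambda>\<^sub>1 G)\<^sup>2 \<le> (\<Sum>u\<in>verts G. real (card (nbrs G u))) - card (verts G) + 1"
proof -
  interpret graph G by fact
  let ?V = "verts G" and ?d = "\<lambda>u. real (card (nbrs G u))"
  obtain f where f: "\<exists>u\<in>?V. f u \<noteq> 0" "\<And>u. u \<in> ?V \<Longrightarrow> (\<Sum>v\<in>nbrs G u. f v) = \<lambda>\<^sub>1 G * f u"
    using largest_eigenvalue(1)[OF G ne] unfolding mem_spectrum_iff[OF finite_verts] by blast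
  \<comment> \<open>The eigenvector may have mixed signs; a vertex with an entry of largest modulus
    suffices, as the eigenvalue equation is applied at \<open>u\<close> and then at its
    neighbours.\<close>
  obtain u where u: "u \<in> ?V" "\<And>v. v \<in> ?V \<Longrightarrow> \<bar>f v\<bar> \<le> \<bar>f u\<bar>"
    using finite_ex_max[OF finite_verts ne, of "\<lambda>u. \<bar>f u\<bar>"] by blast
  with f(1) have fu: "\<bar>f u\<bar> > 0" by fastforce
  have sub: "nbrs G v \<subseteq> ?V" for v by (auto simp: nbrs_def)
  have row: "\<bar>\<lambda>\<^sub>1 G * f v\<bar> \<le> ?d v * \<bar>f u\<bar>" if "v \<in> ?V" for v
  proof -
    have "\<bar>\<lambda>\<^sub>1 G * f v\<bar> \<le> (\<Sum>w\<in>nbrs G v. \<bar>f w\<bar>)"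
      unfolding f(2)[OF that, symmetric] by (rule sum_abs)
    also have "\<dots> \<le> ?d v * \<bar>f u\<bar>" using sub u(2) by (intro sum_bounded_above) auto
    finally show ?thesis .
  qed
  have "(\<lambda>\<^sub>1 G)\<^sup>2 * \<bar>f u\<bar> = \<bar>\<lambda>\<^sub>1 G * (\<Sum>v\<in>nbrs G u. f v)\<bar>"
    unfolding f(2)[OF u(1)] by (simp add: power2_eq_square abs_mult)
  also have "\<dots> \<le> (\<Sum>v\<in>nbrs G u. \<bar>\<lambda>\<^sub>1 G * f v\<bar>)"
    unfolding sum_distrib_left by (rule sum_abs)
  also have "\<dots> \<le> (\<Sum>v\<in>nbrs G u. ?d v * \<bar>f u\<bar>)" using sub row by (intro sum_mono) auto
  also have "\<dots> = (\<Sum>v\<in>nbrs G u. ?d v) * \<bar>f u\<bar>" by (simp add: sum_distrib_right)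
  finally have "(\<lambda>\<^sub>1 G)\<^sup>2 \<le> (\<Sum>v\<in>nbrs G u. ?d v)" using fu by simp
  \<comment> \<open>Outside the neighbourhood, \<open>u\<close> itself contributes its degree and
    each of the remaining n - 1 - deg u vertices at least 1; deg u cancels and n - 1 is
    subtracted.\<close>
  also have "\<dots> = (\<Sum>v\<in>?V. ?d v) - (\<Sum>v\<in>?V - nbrs G u. ?d v)"
    using sum.subset_diff[OF sub[of u] finite_verts, of ?d] by simp
  also have "(\<Sum>v\<in>?V - nbrs G u. ?d v) = ?d u + (\<Sum>v\<in>?V - nbrs G u - {u}. ?d v)"
    using u(1) dominates_neq by (intro sum.remove) (auto simp: nbrs_def)
  finally have "(\<lambda>\<^sub>1 G)\<^sup>2 \<le> (\<Sum>v\<in>?V. ?d v) - (?d u + (\<Sum>v\<in>?V - nbrs G u - {u}. ?d v))" .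
  moreover have "(\<Sum>v\<in>?V - nbrs G u - {u}. ?d v) \<ge> (\<Sum>v\<in>?V - nbrs G u - {u}. 1)"
  proof (rule sum_mono)
    fix v assume "v \<in> ?V - nbrs G u - {u}"
    then have "card (nbrs G v) \<noteq> 0" using deg finite_nbrs by simp
    then show "1 \<le> ?d v" by simp
  qed
  moreover have "(\<Sum>v\<in>?V - nbrs G u - {u}. 1) = real (card ?V) - ?d u - 1"
  proof -
    have "u \<notin> nbrs G u" using dominates_neq by (auto simp: nbrs_def)
    then have *: "insert u (nbrs G u) \<subseteq> ?V" "card (insert u (nbrs G u)) = card (nbrs G u) + 1"
      using u(1) sub finite_nbrs by auto
    have "?V - nbrs G u - {u} = ?V - insert u (nbrs G u)" by blast
    then show ?thesis
      using card_Diff_subset[OF _ *(1)] card_mono[OF finite_verts *(1)] *(2) finite_nbrs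
      by (simp add: of_nat_diff)
  qed
  ultimately show ?thesis by simp
qed


section \<open>Obstructions to fractional factors\<close>

text \<open>
  The squared distance of the weighted degrees to \<open>[a, b]\<close> is minimised over all weightings.  With
  the residuals \<open>p\<close> of a minimiser, an edge has weight one or zero according to whether the sum of
  \<open>p\<close> over its ends is positive or negative; hence the vertices of maximal \<open>\<bar>p\<bar>\<close>, split by the sign
  of \<open>p\<close>, are the sets \<open>S\<close> and \<open>T\<close>.
\<close>

lemma no_fractional_factor_obstruction:
  assumes G: "graph G" and ab: "a \<le> b" and no: "\<not> has_fractional_factor a b G"
  shows "\<exists>S T. S \<subseteq> verts G \<and> T \<subseteq> verts G \<and> S \<inter> T = {} \<and>
    b * card S + (\<Sum>v\<in>T. card (nbrs G v - S)) < a * card T"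
proof -
  interpret graph G by fact
  let ?V = "verts G" and ?E = "edges G"
  have E: "\<exists>u v. e = {u, v} \<and> u \<rightarrow>\<^bsub>G\<^esub> v \<and> u \<noteq> v \<and> u \<in> ?V \<and> v \<in> ?V" if "e \<in> ?E" for e
    using that dominates_neq dominates_verts unfolding edges_def by blast
  then have "?E \<subseteq> Pow ?V" by blast
  then have finE: "finite ?E" by (rule finite_subset) simp
  define d where "d h v = (\<Sum>e | e \<in> ?E \<and> v \<in> e. h e)" for h :: "'a set \<Rightarrow> real" and v
  define \<psi> where "\<psi> x = (max 0 (real a - x))\<^sup>2 + (max 0 (x - real b))\<^sup>2" for x
  \<comment> \<open>Signed so that \<open>x + res x\<close> is the point of [a, b] nearest to
    \<open>x\<close>: positive below \<open>a\<close>, negative above \<open>b\<close>.\<close>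
  define res where "res x = max 0 (real a - x) - max 0 (x - real b)" for x
  \<comment> \<open>The distance of \<open>x + e\<close> to [a, b] is at most its distance to the
    nearest point of \<open>x\<close>; this replaces differentiating \<open>\<psi>\<close>.\<close>
  have psi: "\<psi> (x + e) \<le> \<psi> x - 2 * e * res x + e\<^sup>2" for x e
  proof -
    have "\<psi> x = (res x)\<^sup>2"
      using ab by (auto simp: \<psi>_def res_def max_def power2_eq_square algebra_simps)
    moreover have "\<psi> (x + e) \<le> (e - res x)\<^sup>2"
    proof -
      have "\<psi> y \<le> (y - z)\<^sup>2" if "real a \<le> z" "z \<le> real b" for y z
      proof -
        consider "y < real a" | "real a \<le> y" "y \<le> real b" | "real b < y" by linarith
        then show ?thesis
        proof cases
          case 1
          then have "(real a - y)\<^sup>2 \<le> (z - y)\<^sup>2" using that by (intro power_mono) auto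
          with 1 that show ?thesis by (simp add: \<psi>_def power2_commute[of z])
        next
          case 3
          then have "(y - real b)\<^sup>2 \<le> (y - z)\<^sup>2" using that by (intro power_mono) auto
          with 3 that show ?thesis by (simp add: \<psi>_def)
        qed (simp add: \<psi>_def)
      qed
      from this[of "x + res x" "x + e"] show ?thesis
        using ab by (auto simp: res_def max_def algebra_simps split: if_splits)
    qed
    ultimately show ?thesis by (simp add: power2_diff)
  qed
  define F where "F h = (\<Sum>v\<in>?V. \<psi> (d h v))" for h
  have "continuous_on UNIV F"
    unfolding F_def \<psi>_def d_def
    by (intro continuous_intros continuous_on_max) (auto intro!: continuous_on_product_coordinates)
  \<comment> \<open>Every vertex set is a coordinate; those that are not edges are frozen at 0 by
    the upper bound.\<close>
  then have "\<exists>x. (\<forall>e. 0 \<le> x e \<and> x e \<le> of_bool (e \<in> ?E)) \<and>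
      (\<forall>y. (\<forall>e. 0 \<le> y e \<and> y e \<le> of_bool (e \<in> ?E)) \<longrightarrow> F x \<le> F y)"
    by (intro ex_minimizer_box) auto
  then obtain x where x: "\<And>e. 0 \<le> x e" "\<And>e. x e \<le> of_bool (e \<in> ?E)"
    and min: "\<And>y. (\<And>e. 0 \<le> y e \<and> y e \<le> of_bool (e \<in> ?E)) \<Longrightarrow> F x \<le> F y" by blast
  define p where "p v = res (d x v)" for v
  \<comment> \<open>Only the degrees at \<open>u\<close> and \<open>v\<close> change, so by
    \<open>psi\<close> the objective grows by at most
    \<open>2 * \<epsilon>\<^sup>2 - 2 * \<epsilon> * (p u + p v)\<close>, and minimality makes this
    nonnegative.\<close>
  have variation: "\<epsilon> * (p u + p v) \<le> \<epsilon>\<^sup>2"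
    if uv: "u \<rightarrow>\<^bsub>G\<^esub> v" and \<epsilon>: "0 \<le> x {u, v} + \<epsilon>" "x {u, v} + \<epsilon> \<le> 1" for u v \<epsilon>
  proof -
    let ?e = "{u, v}"
    let ?y = "\<lambda>e. x e + \<epsilon> * of_bool (e = ?e)"
    have e: "?e \<in> ?E" using uv by (auto simp: edges_def)
    have d: "d ?y w = d x w + \<epsilon> * of_bool (w \<in> ?e)" for w
    proof -
      have "(\<Sum>e | e \<in> ?E \<and> w \<in> e. \<epsilon> * of_bool (e = ?e)) =
          (\<Sum>e | e \<in> ?E \<and> w \<in> e. if e = ?e then \<epsilon> else 0)" by (intro sum.cong) auto
      also have "\<dots> = \<epsilon> * of_bool (w \<in> ?e)"
        using finE e by (subst sum.delta) auto
      finally show ?thesis by (simp add: d_def sum.distrib)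
    qed
    have "0 \<le> ?y e \<and> ?y e \<le> of_bool (e \<in> ?E)" for e
      using x(1)[of e] x(2)[of e] \<epsilon> \<open>?e \<in> ?E\<close> by (cases "e = ?e") simp_all
    then have "F x \<le> F ?y" by (rule min)
    also have "\<dots> \<le> (\<Sum>w\<in>?V. \<psi> (d x w) + (if w \<in> ?e then \<epsilon>\<^sup>2 - 2 * \<epsilon> * p w else 0))"
      unfolding F_def d
    proof (rule sum_mono)
      show "\<psi> (d x w + \<epsilon> * of_bool (w \<in> ?e)) \<le>
          \<psi> (d x w) + (if w \<in> ?e then \<epsilon>\<^sup>2 - 2 * \<epsilon> * p w else 0)" for w
        using psi[of "d x w" \<epsilon>] by (cases "w \<in> ?e") (auto simp: p_def)
    qed
    also have "\<dots> = F x + (\<Sum>w\<in>?V. if w \<in> ?e then \<epsilon>\<^sup>2 - 2 * \<epsilon> * p w else 0)"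
      by (simp add: F_def sum.distrib)
    also have "(\<Sum>w\<in>?V. if w \<in> ?e then \<epsilon>\<^sup>2 - 2 * \<epsilon> * p w else 0) =
        (\<Sum>w\<in>?e. \<epsilon>\<^sup>2 - 2 * \<epsilon> * p w)"
      using uv dominates_verts by (intro sum.mono_neutral_cong_right) auto
    also have "\<dots> = 2 * \<epsilon>\<^sup>2 - 2 * (\<epsilon> * (p u + p v))"
      using dominates_neq[OF uv] by (simp add: algebra_simps)
    finally show ?thesis by simp
  qed
  have one: "x {u, v} = 1" if uv: "u \<rightarrow>\<^bsub>G\<^esub> v" and pos: "p u + p v > 0" for u v
  proof (rule ccontr)
    assume neq: "x {u, v} \<noteq> 1"
    have "{u, v} \<in> ?E" using uv by (auto simp: edges_def)
    then have lt: "x {u, v} < 1" using x(2)[of "{u, v}"] neq by simp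
    \<comment> \<open>The first bound keeps the weight at most 1, the second makes the quadratic
      term smaller than the linear one.\<close>
    define \<epsilon> where "\<epsilon> = min (1 - x {u, v}) ((p u + p v) / 2)"
    have \<epsilon>: "\<epsilon> > 0" "\<epsilon> < p u + p v" "x {u, v} + \<epsilon> \<le> 1" using lt pos by (auto simp: \<epsilon>_def min_def field_simps)
    have "\<epsilon> * (p u + p v) \<le> \<epsilon> * \<epsilon>"
      using variation[OF uv, of \<epsilon>] x(1)[of "{u, v}"] \<epsilon> by (simp add: power2_eq_square)
    from mult_left_le_imp_le[OF this \<epsilon>(1)] \<epsilon>(2) show False by simp
  qed
  have zero: "x {u, v} = 0" if uv: "u \<rightarrow>\<^bsub>G\<^esub> v" and neg: "p u + p v < 0" for u v
  proof (rule ccontr)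
    assume neq: "x {u, v} \<noteq> 0"
    have "{u, v} \<in> ?E" using uv by (auto simp: edges_def)
    then have x1: "x {u, v} \<le> 1" using x(2)[of "{u, v}"] by simp
    have x0: "x {u, v} > 0" using x(1)[of "{u, v}"] neq by simp
    define \<epsilon> where "\<epsilon> = min (x {u, v}) (- (p u + p v) / 2)"
    have \<epsilon>: "\<epsilon> > 0" "\<epsilon> < - (p u + p v)" "x {u, v} - \<epsilon> \<ge> 0" using x0 neg by (auto simp: \<epsilon>_def min_def field_simps)
    have "\<epsilon> * (- (p u + p v)) \<le> \<epsilon> * \<epsilon>"
      using variation[OF uv, of "- \<epsilon>"] x1 \<epsilon> by (simp add: power2_eq_square algebra_simps)
    from mult_left_le_imp_le[OF this \<epsilon>(1)] \<epsilon>(2) show False by simp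
  qed
  have "\<forall>e\<in>?E. 0 \<le> x e \<and> x e \<le> 1" using x by (metis of_bool_eq(2))
  with no obtain v0 where v0: "v0 \<in> ?V" "\<not> (real a \<le> d x v0 \<and> d x v0 \<le> real b)"
    unfolding has_fractional_factor_def d_def by blast
  then have "p v0 \<noteq> 0" using ab by (auto simp: p_def res_def max_def)
  obtain m where m: "m \<in> ?V" "\<And>v. v \<in> ?V \<Longrightarrow> \<bar>p v\<bar> \<le> \<bar>p m\<bar>"
    using finite_ex_max[OF finite_verts, of "\<lambda>v. \<bar>p v\<bar>"] v0(1) by blast
  define t where "t = \<bar>p m\<bar>"
  have t: "t > 0" using m(2)[OF v0(1)] \<open>p v0 \<noteq> 0\<close> by (simp add: t_def)
  have pt: "- t \<le> p v" "p v \<le> t" if "v \<in> ?V" for v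
    using m(2)[OF that] by (auto simp: t_def abs_le_iff)
  \<comment> \<open>Since t > 0, vertices of \<open>S\<close> have weighted degree exactly b + t and
    those of \<open>T\<close> exactly a - t.\<close>
  define S where "S = {v \<in> ?V. p v = - t}"
  define T where "T = {v \<in> ?V. p v = t}"
  have sub: "S \<subseteq> ?V" "T \<subseteq> ?V" "S \<inter> T = {}" using t by (auto simp: S_def T_def)
  have fin: "finite S" "finite T" using sub finite_verts finite_subset by blast+
  have dnbrs: "d x v = (\<Sum>w\<in>nbrs G v. x {v, w})" if "v \<in> ?V" for v
  proof -
    have "inj_on (\<lambda>w. {v, w}) (nbrs G v)" by (auto simp: inj_on_def doubleton_eq_iff)
    moreover have "{e. e \<in> ?E \<and> v \<in> e} = (\<lambda>w. {v, w}) ` nbrs G v"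
      using dominates_sym dominates_verts by (auto simp: edges_def nbrs_def insert_commute)
    ultimately show ?thesis by (simp add: d_def sum.reindex)
  qed
  \<comment> \<open>Edges from \<open>v\<close> to vertices outside \<open>S\<close> have positive
    residual sum, hence weight 1; only those into \<open>S\<close> stay undetermined.\<close>
  have dT: "real (card (nbrs G v - S)) + (\<Sum>w\<in>S. of_bool (v \<rightarrow>\<^bsub>G\<^esub> w) * x {v, w}) = real a - t"
    if v: "v \<in> T" for v
  proof -
    have vV: "v \<in> ?V" and pv: "p v = t" using v by (auto simp: T_def)
    have "real a - t = d x v" using pv t ab by (auto simp: p_def res_def max_def split: if_splits)
    also have "\<dots> = (\<Sum>w\<in>nbrs G v - S. x {v, w}) + (\<Sum>w\<in>nbrs G v \<inter> S. x {v, w})"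
      unfolding dnbrs[OF vV] using finite_nbrs
      by (subst sum.Int_Diff[of _ _ S]) (auto simp: add.commute)
    also have "(\<Sum>w\<in>nbrs G v - S. x {v, w}) = (\<Sum>w\<in>nbrs G v - S. 1)"
    proof (rule sum.cong[OF refl])
      fix w assume w: "w \<in> nbrs G v - S"
      then have "w \<in> ?V" "p w \<noteq> - t" by (auto simp: nbrs_def S_def)
      then have "p v + p w > 0" using pt(1)[of w] pv by simp
      with w show "x {v, w} = 1" by (intro one) (auto simp: nbrs_def)
    qed
    also have "nbrs G v \<inter> S = {w \<in> S. v \<rightarrow>\<^bsub>G\<^esub> w}" using sub by (auto simp: nbrs_def)
    also have "sum (\<lambda>w. x {v, w}) \<dots> = (\<Sum>w\<in>S. of_bool (v \<rightarrow>\<^bsub>G\<^esub> w) * x {v, w})"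
      by (rule sum_filter_of_bool[OF fin(1)])
    finally show ?thesis by simp
  qed
  \<comment> \<open>Edges from \<open>w\<close> to vertices outside \<open>T\<close> have negative
    residual sum, hence weight 0.\<close>
  have dS: "(\<Sum>v\<in>T. of_bool (v \<rightarrow>\<^bsub>G\<^esub> w) * x {v, w}) = real b + t" if w: "w \<in> S" for w
  proof -
    have wV: "w \<in> ?V" and pw: "p w = - t" using w by (auto simp: S_def)
    have "real b + t = d x w" using pw t ab by (auto simp: p_def res_def max_def split: if_splits)
    also have "\<dots> = (\<Sum>v\<in>nbrs G w \<inter> T. x {w, v})"
      unfolding dnbrs[OF wV]
    proof (rule sum.mono_neutral_right)
      show "\<forall>v\<in>nbrs G w - nbrs G w \<inter> T. x {w, v} = 0"
      proof
        fix v assume v: "v \<in> nbrs G w - nbrs G w \<inter> T"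
        then have "v \<in> ?V" "p v \<noteq> t" by (auto simp: nbrs_def T_def)
        then have "p w + p v < 0" using pt(2)[of v] pw by simp
        with v show "x {w, v} = 0" by (intro zero) (auto simp: nbrs_def)
      qed
    qed (auto simp: finite_nbrs)
    also have "nbrs G w \<inter> T = {v \<in> T. v \<rightarrow>\<^bsub>G\<^esub> w}"
      using sub dominates_sym by (auto simp: nbrs_def)
    also have "sum (\<lambda>v. x {w, v}) \<dots> = (\<Sum>v\<in>T. of_bool (v \<rightarrow>\<^bsub>G\<^esub> w) * x {w, v})"
      by (rule sum_filter_of_bool[OF fin(2)])
    finally show ?thesis by (simp add: insert_commute)
  qed
  \<comment> \<open>The undetermined weight between \<open>T\<close> and \<open>S\<close> is counted
    from both sides and eliminated. The surplus t (|S| + |T|) > 0 makes the inequality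
    strict.\<close>
  have "real (card T) * (real a - t) = (\<Sum>v\<in>T. real a - t)" by simp
  also have "\<dots> = (\<Sum>v\<in>T. real (card (nbrs G v - S))) +
      (\<Sum>v\<in>T. \<Sum>w\<in>S. of_bool (v \<rightarrow>\<^bsub>G\<^esub> w) * x {v, w})"
    unfolding sum.distrib[symmetric] by (intro sum.cong refl dT[symmetric])
  also have "(\<Sum>v\<in>T. \<Sum>w\<in>S. of_bool (v \<rightarrow>\<^bsub>G\<^esub> w) * x {v, w}) = real (card S) * (real b + t)"
    by (subst sum.swap) (simp add: dS)
  finally have eq: "real (card T) * a =
      (\<Sum>v\<in>T. real (card (nbrs G v - S))) + real (card S) * b + t * (real (card S) + real (card T))"
    by (simp add: algebra_simps)
  have "m \<in> S \<or> m \<in> T" using m(1) by (auto simp: S_def T_def t_def abs_if)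
  then have "card S > 0 \<or> card T > 0" using fin by (auto simp: card_gt_0_iff)
  then have "t * (real (card S) + real (card T)) > 0" using t by (intro mult_pos_pos) auto
  with eq have "real (b * card S + (\<Sum>v\<in>T. card (nbrs G v - S))) < real (a * card T)"
    by (simp add: mult.commute)
  then have "b * card S + (\<Sum>v\<in>T. card (nbrs G v - S)) < a * card T" by (simp only: of_nat_less_iff)
  with sub show ?thesis by blast
qed

section \<open>Induced subgraphs and their neighbourhoods\<close>

lemma graph_induce_subgraph:
  assumes G: "graph G" and W: "W \<subseteq> verts G"
  shows "graph (G \<restriction> W)"
proof -
  interpret graph G by fact
  interpret W: sym_digraph "G \<restriction> W"
    using W by (intro induced_graph_imp_graph induced_induce)
  show ?thesis
    using W finite_subset[OF W]
    by unfold_locales (auto intro: no_multi_arcs dest: no_loops)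
qed

lemma nbrs_induce_subgraph:
  assumes "graph G" "W \<subseteq> verts G" "v \<in> W"
  shows "nbrs (G \<restriction> W) v = nbrs G v \<inter> W"
  using assms by (auto simp: nbrs_def arcs_ends_conv)


section \<open>The extremal graph\<close>

lemma disjoint_union_simps:
  "Inl u \<in> pverts (disjoint_union G H) \<longleftrightarrow> u \<in> pverts G"
  "Inr w \<in> pverts (disjoint_union G H) \<longleftrightarrow> w \<in> pverts H"
  "(Inl u, Inl u') \<in> parcs (disjoint_union G H) \<longleftrightarrow> (u, u') \<in> parcs G"
  "(Inr w, Inr w') \<in> parcs (disjoint_union G H) \<longleftrightarrow> (w, w') \<in> parcs H"
  "(Inl u, Inr w) \<notin> parcs (disjoint_union G H)"
  "(Inr w, Inl u) \<notin> parcs (disjoint_union G H)"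
  by (auto simp: disjoint_union_def)

lemma join_simps:
  "Inl u \<in> pverts (join G H) \<longleftrightarrow> u \<in> pverts G"
  "Inr w \<in> pverts (join G H) \<longleftrightarrow> w \<in> pverts H"
  "(Inl u, Inl u') \<in> parcs (join G H) \<longleftrightarrow> (u, u') \<in> parcs G"
  "(Inr w, Inr w') \<in> parcs (join G H) \<longleftrightarrow> (w, w') \<in> parcs H"
  "(Inl u, Inr w) \<in> parcs (join G H) \<longleftrightarrow> u \<in> pverts G \<and> w \<in> pverts H"
  "(Inr w, Inl u) \<in> parcs (join G H) \<longleftrightarrow> u \<in> pverts G \<and> w \<in> pverts H"
  by (auto simp: join_def disjoint_union_def)

lemma sum4_exhaust:
  obtains i where "x = Inl i" | i where "x = Inr (Inl i)" | i where "x = Inr (Inr (Inl i))"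
    | i where "x = Inr (Inr (Inr i))"
proof (cases x)
  case (Inr y)
  then show ?thesis using that by (cases y; cases "projr y") auto
qed (rule that)

lemmas H_graph_simps = H_graph_def disjoint_union_simps join_simps complete_graph_def edgeless_graph_def

text \<open>The description by nonadjacent pairs serves both the eigenvalue estimate and the
  embedding. \<open>Inl\<close> marks the edgeless part, \<open>Inr (Inr (Inl k))\<close> the large
  clique and \<open>Inr (Inr (Inr 0))\<close> the single vertex.\<close>

lemma arc_H_graph_iff:
  assumes "x \<in> pverts (H_graph n a r)" "y \<in> pverts (H_graph n a r)" "x \<noteq> y"
  shows "(x, y) \<in> parcs (H_graph n a r) \<longleftrightarrow> \<not> (isl x \<and> isl y) \<and>
    \<not> (x = Inr (Inr (Inr 0)) \<and> y \<in> range (\<lambda>k. Inr (Inr (Inl k)))) \<and>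
    \<not> (y = Inr (Inr (Inr 0)) \<and> x \<in> range (\<lambda>k. Inr (Inr (Inl k))))"
  using assms
  by (cases x rule: sum4_exhaust; cases y rule: sum4_exhaust) (simp_all add: H_graph_simps image_iff)

lemma pverts_H_graph:
  "pverts (H_graph n a r) = Inl ` {..<r} \<union> (\<lambda>k. Inr (Inl k)) ` {..<a - 1} \<union>
    (\<lambda>k. Inr (Inr (Inl k))) ` {..<n - a - r} \<union> {Inr (Inr (Inr 0))}" (is "_ = ?R")
proof (rule equalityI; rule subsetI)
  fix x assume "x \<in> pverts (H_graph n a r)"
  then show "x \<in> ?R" by (cases x rule: sum4_exhaust) (simp_all add: H_graph_simps image_iff)
next
  fix x assume "x \<in> ?R"
  then show "x \<in> pverts (H_graph n a r)" by (auto simp: H_graph_simps)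
qed

text \<open>
  The test vector is the indicator of the complement of the \<open>K\<^sub>1\<close>, so that the Rayleigh quotient is
  the average degree of the remaining graph, \<open>n - 1\<close> vertices with at most \<open>r * (r - 1)\<close> arcs missing.
\<close>

lemma largest_eigenvalue_H_graph_ge:
  assumes a: "a \<ge> 1" and n: "n \<ge> a + r"
  shows "(real n - 1) * (real n - 2) - real r * (real r - 1)
    \<le> \<lambda>\<^sub>1 (with_proj (H_graph n a r)) * (real n - 1)"
proof -
  let ?H = "with_proj (H_graph n a r)" and ?z = "Inr (Inr (Inr 0)) :: nat + nat + nat + nat"
  interpret H: graph ?H by (rule graph_H_graph)
  let ?V = "pverts (H_graph n a r)"
  have fin: "finite ?V" using H.finite_verts by simp
  have z: "?z \<in> ?V" by (simp add: pverts_H_graph)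
  define f l :: "nat + nat + nat + nat \<Rightarrow> real" where "f x = of_bool (x \<noteq> ?z)" and "l x = of_bool (isl x)" for x
  have "sum f ?V = real (card (?V - {?z}))"
    using fin by (simp add: f_def Int_def set_diff_eq)
  then have sf: "sum f ?V = real n - 1"
    using card_verts_H_graph[OF a n] z fin a n by (simp add: of_nat_diff)
  have "?V \<inter> {x. isl x} = Inl ` {..<r}" by (auto simp: pverts_H_graph)
  then have sl: "sum l ?V = real r" using fin by (simp add: l_def card_image)
  have delta: "(\<Sum>y\<in>?V. of_bool (y = x) * c) = c" if "x \<in> ?V" for x and c :: real
  proof -
    have "(\<Sum>y\<in>?V. of_bool (y = x) * c) = (\<Sum>y\<in>?V. if y = x then c else 0)" by (intro sum.cong) auto
    then show ?thesis using fin that by simp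
  qed
  \<comment> \<open>Both sides become sums over ordered pairs and are compared termwise: a
    nonadjacent pair of distinct vertices avoiding \<open>?z\<close> lies in the edgeless part,
    where the \<open>l\<close> terms compensate.\<close>
  have "(real n - 1) * (real n - 1) - (real n - 1) - (real r * real r - real r) =
      (\<Sum>x\<in>?V. \<Sum>y\<in>?V. f x * f y) - (\<Sum>x\<in>?V. f x) - ((\<Sum>x\<in>?V. \<Sum>y\<in>?V. l x * l y) - (\<Sum>x\<in>?V. l x))"
    by (simp only: sum_product[symmetric] sf sl)
  also have "\<dots> = (\<Sum>x\<in>?V. \<Sum>y\<in>?V.
      f x * f y - of_bool (y = x) * f x - (l x * l y - of_bool (y = x) * l x))"
    by (simp add: sum_subtractf delta)
  also have "\<dots> \<le> adj_form ?H f"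
    unfolding quad_form_double_sum[OF H.finite_verts] unfolding with_proj_simps
  proof (intro sum_mono)
    fix x y assume xy: "x \<in> ?V" "y \<in> ?V"
    show "f x * f y - of_bool (y = x) * f x - (l x * l y - of_bool (y = x) * l x)
        \<le> of_bool ((x, y) \<in> parcs (H_graph n a r)) * (f x * f y)"
    proof (cases "x = y")
      case True
      then show ?thesis by (simp add: f_def l_def)
    next
      case False
      then show ?thesis
        using arc_H_graph_iff[OF xy] by (auto simp: f_def l_def)
    qed
  qed
  also have "\<dots> \<le> \<lambda>\<^sub>1 ?H * (\<Sum>x\<in>verts ?H. (f x)\<^sup>2)"
    using z by (intro rayleigh_largest_eigenvalue(2)[OF graph_H_graph]) auto
  also have "(\<Sum>x\<in>verts ?H. (f x)\<^sup>2) = real n - 1"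
    unfolding sf[symmetric] by (intro sum.cong) (auto simp: f_def)
  finally show ?thesis by (simp add: algebra_simps)
qed

text \<open>\<open>I\<close> goes to the edgeless part and \<open>v\<close> to the single vertex.
  The neighbours of \<open>v\<close> outside \<open>I\<close>, padded to a set \<open>A\<close> of
  exactly a - 1 vertices, go to the small clique and the rest \<open>B\<close> to the large one.
  Pairs not joined in H then lie inside \<open>I\<close> or between \<open>v\<close> and
  \<open>B\<close>, where \<open>G\<close> has no edges.\<close>

lemma H_graph_embedding:
  assumes G: "graph G" and I: "independent_set G I" "card I = r" and v: "v \<in> verts G - I"
    and deg: "card (nbrs G v - I) < a" and n: "card (verts G) = n" "n \<ge> a + r"
  shows "\<exists>\<phi>. bij_betw \<phi> (verts G) (pverts (H_graph n a r)) \<and>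
    (\<forall>u w. u \<rightarrow>\<^bsub>G\<^esub> w \<longrightarrow> (\<phi> u, \<phi> w) \<in> parcs (H_graph n a r))"
proof -
  interpret graph G by fact
  let ?V = "verts G"
  have IV: "I \<subseteq> ?V" and ind: "\<And>u w. u \<in> I \<Longrightarrow> w \<in> I \<Longrightarrow> \<not> u \<rightarrow>\<^bsub>G\<^esub> w"
    using I(1) by (auto simp: independent_set_def)
  have finI: "finite I" by (rule finite_subset[OF IV]) simp
  have "1 \<le> a" using deg by linarith
  have cW: "card (?V - I - {v}) = n - r - 1"
    using v IV finI I(2) n(1) by (simp add: card_Diff_subset)
  have "\<exists>A. nbrs G v - I \<subseteq> A \<and> A \<subseteq> ?V - I - {v} \<and> card A = a - 1"
  proof (rule exists_subset_between)
    show "nbrs G v - I \<subseteq> ?V - I - {v}" by (auto simp: nbrs_def dest: dominates_neq)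
    show "card (nbrs G v - I) \<le> a - 1" using deg by linarith
    show "a - 1 \<le> card (?V - I - {v})" unfolding cW using n(2) by linarith
  qed simp
  then obtain A where A: "nbrs G v - I \<subseteq> A" "A \<subseteq> ?V - I - {v}" "card A = a - 1" by blast
  define B where "B = ?V - I - {v} - A"
  have finA: "finite A" by (rule finite_subset[OF A(2)]) simp
  have finB: "finite B" by (simp add: B_def)
  have cB: "card B = n - a - r"
    using A(2,3) deg cW finA by (simp add: B_def card_Diff_subset)
  obtain i where i: "i ` I = {..<r}"
    using ex_bij_betw_finite_nat[OF finI] I(2) by (auto simp: bij_betw_def lessThan_atLeast0)
  obtain j where j: "j ` A = {..<a - 1}"
    using ex_bij_betw_finite_nat[OF finA] A(3) by (auto simp: bij_betw_def lessThan_atLeast0)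
  obtain k where k: "k ` B = {..<n - a - r}"
    using ex_bij_betw_finite_nat[OF finB] cB by (auto simp: bij_betw_def lessThan_atLeast0)
  define \<phi> :: "_ \<Rightarrow> nat + nat + nat + nat" where
    "\<phi> u = (if u \<in> I then Inl (i u) else if u \<in> A then Inr (Inl (j u))
      else if u \<in> B then Inr (Inr (Inl (k u))) else Inr (Inr (Inr 0)))" for u
  have V: "?V = I \<union> A \<union> B \<union> {v}" using IV A(2) v by (auto simp: B_def)
  have disj: "I \<inter> A = {}" "I \<inter> B = {}" "A \<inter> B = {}" "v \<notin> I" "v \<notin> A" "v \<notin> B"
    using A(2) v by (auto simp: B_def)
  have "\<phi> ` I = Inl ` {..<r}" unfolding i[symmetric] image_image by (intro image_cong) (auto simp: \<phi>_def)
  moreover have "\<phi> ` A = (\<lambda>k. Inr (Inl k)) ` {..<a - 1}"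
    unfolding j[symmetric] image_image by (intro image_cong) (use disj in \<open>auto simp: \<phi>_def\<close>)
  moreover have "\<phi> ` B = (\<lambda>k. Inr (Inr (Inl k))) ` {..<n - a - r}"
    unfolding k[symmetric] image_image by (intro image_cong) (use disj in \<open>auto simp: \<phi>_def\<close>)
  moreover have "\<phi> v = Inr (Inr (Inr 0))" using disj by (simp add: \<phi>_def)
  ultimately have img: "\<phi> ` ?V = pverts (H_graph n a r)"
    by (simp add: V pverts_H_graph image_Un Un_assoc)
  \<comment> \<open>Only the images of the numberings \<open>i\<close>, \<open>j\<close>,
    \<open>k\<close> are known; injectivity follows because the image has as many elements as
    \<open>?V\<close>.\<close>
  moreover have inj: "inj_on \<phi> ?V"
  proof (rule eq_card_imp_inj_on)
    show "card (\<phi> ` ?V) = card ?V"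
      using card_verts_H_graph[OF \<open>1 \<le> a\<close> n(2)] n(1) by (simp add: img)
  qed simp
  ultimately have bij: "bij_betw \<phi> ?V (pverts (H_graph n a r))" by (simp add: bij_betw_def)
  have isl: "isl (\<phi> x) \<longleftrightarrow> x \<in> I" for x by (simp add: \<phi>_def)
  have B: "\<phi> x \<in> range (\<lambda>k. Inr (Inr (Inl k))) \<Longrightarrow> x \<in> B" for x
    by (auto simp: \<phi>_def split: if_splits)
  have z: "x = v" if "\<phi> x = Inr (Inr (Inr 0))" "x \<in> ?V" for x
    using that unfolding V by (auto simp: \<phi>_def split: if_splits)
  have vB: "x \<notin> B" if "v \<rightarrow>\<^bsub>G\<^esub> x" for x
    using that A(1) by (auto simp: B_def nbrs_def)
  have "(\<phi> u, \<phi> w) \<in> parcs (H_graph n a r)" if uw: "u \<rightarrow>\<^bsub>G\<^esub> w" for u w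
  proof -
    have V': "u \<in> ?V" "w \<in> ?V" and neq: "u \<noteq> w"
      using dominates_verts[OF uw] dominates_neq[OF uw] by auto
    have neq': "\<phi> u \<noteq> \<phi> w" using inj_onD[OF inj _ V'] neq by blast
    have H: "\<phi> u \<in> pverts (H_graph n a r)" "\<phi> w \<in> pverts (H_graph n a r)" using img V' by blast+
    show ?thesis
      unfolding arc_H_graph_iff[OF H neq'] isl
      using ind[of u w] uw dominates_sym[OF uw] z[OF _ V'(1)] z[OF _ V'(2)] B[of u] B[of w] vB by blast
  qed
  with bij show ?thesis by blast
qed


section \<open>Counting the missing edges\<close>

lemma card_offdiagonal:
  assumes A: "finite A"
  shows "real (card (A \<times> A - Id_on A)) = real (card A) * (real (card A) - 1)"
proof -
  have Id: "Id_on A = (\<lambda>x. (x, x)) ` A" by (auto simp: Id_on_def)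
  have "card (Id_on A) = card A" unfolding Id by (intro card_image) (auto simp: inj_on_def)
  moreover have "Id_on A \<subseteq> A \<times> A" "finite (Id_on A)" using A by (auto simp: Id)
  moreover have "card A \<le> card A * card A" by simp
  ultimately show ?thesis by (simp add: card_Diff_subset card_cartesian_product of_nat_diff algebra_simps)
qed

text \<open>Disjoint sets of ordered pairs are counted in V x V: the arcs \<open>P\<close>, the
  diagonal, the pairs \<open>J\<close> inside \<open>I\<close>, and the nonadjacent pairs outside
  \<open>I\<close> and \<open>S\<close> with an end in \<open>T\<close>, which are \<open>X\<close>
  and its converse.\<close>

lemma sum_degrees_le:
  assumes G: "graph G" and I: "independent_set G I"
    and S: "S \<subseteq> verts G - I" and T: "T \<subseteq> verts G - I" and ST: "S \<inter> T = {}"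
  defines "n \<equiv> real (card (verts G))" and "r \<equiv> real (card I)"
    and "s \<equiv> real (card S)" and "t \<equiv> real (card T)"
  shows "(\<Sum>v\<in>verts G. real (card (nbrs G v))) + n + r * (r - 1) + 2 * t * (n - r - s - 1)
    \<le> n\<^sup>2 + 2 * (\<Sum>v\<in>T. real (card (nbrs G v - I - S))) + t * (t - 1)"
proof -
  interpret graph G by fact
  let ?V = "verts G" and ?D = "\<Sum>v\<in>T. real (card (nbrs G v - I - S))"
  have IV: "I \<subseteq> ?V" and ind: "\<And>u w. u \<in> I \<Longrightarrow> w \<in> I \<Longrightarrow> \<not> u \<rightarrow>\<^bsub>G\<^esub> w"
    using I by (auto simp: independent_set_def)
  have fin: "finite I" "finite S" "finite T"
    using IV S T finite_verts by (meson finite_Diff finite_subset)+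
  define P where "P = Sigma ?V (nbrs G)"
  define J where "J = I \<times> I - Id_on I"
  define X where "X = Sigma T (\<lambda>v. ?V - I - S - {v} - nbrs G v)"
  have finX: "finite P" "finite J" "finite X" "finite (X\<inverse>)" "finite (Id_on ?V)"
    using fin finite_nbrs by (auto simp: P_def J_def X_def Id_on_def)
  have cP: "real (card P) = (\<Sum>v\<in>?V. real (card (nbrs G v)))"
    by (simp add: P_def finite_nbrs)
  have cX: "real (card X) = t * (n - r - s - 1) - ?D"
  proof -
    have "real (card (?V - I - S - {v} - nbrs G v)) = n - r - s - 1 - real (card (nbrs G v - I - S))"
      if v: "v \<in> T" for v
    proof -
      let ?W = "?V - I - S" and ?N = "insert v (nbrs G v - I - S)"
      have "?N \<subseteq> ?W" using v S T ST by (auto simp: nbrs_def)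
      moreover have "card ?N = card (nbrs G v - I - S) + 1"
        using dominates_neq finite_nbrs by (subst card_insert_disjoint) (auto simp: nbrs_def)
      moreover have "real (card ?W) = n - r - s"
        using IV S fin card_mono[OF finite_verts IV] card_mono[OF _ S]
        by (simp add: n_def r_def s_def card_Diff_subset of_nat_diff)
      moreover have "?V - I - S - {v} - nbrs G v = ?W - ?N" by blast
      moreover have "finite ?N" "finite ?W" using finite_nbrs by auto
      ultimately show ?thesis
        using card_mono[of ?W ?N] by (simp add: card_Diff_subset of_nat_diff)
    qed
    then show ?thesis
      by (simp add: X_def t_def fin sum_subtractf)
  qed
  \<comment> \<open>A pair in both \<open>X\<close> and its converse has both ends in
    \<open>T\<close>; this overlap costs at most t (t - 1).\<close>
  have cI: "card (X \<inter> X\<inverse>) \<le> card (T \<times> T - Id_on T)"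
    using fin by (intro card_mono) (auto simp: X_def)
  have "card (X\<inverse>) = card X" by simp
  then have cU: "2 * real (card X) \<le> real (card (X \<union> X\<inverse>)) + t * (t - 1)"
    using card_Un_Int[OF finX(3,4)] cI card_offdiagonal[OF fin(3)] by (simp add: t_def)
  have "P \<inter> Id_on ?V = {}" by (auto simp: P_def nbrs_def dest: dominates_neq)
  moreover have "(P \<union> Id_on ?V) \<inter> J = {}" using ind by (auto simp: P_def J_def nbrs_def)
  moreover have "(P \<union> Id_on ?V \<union> J) \<inter> (X \<union> X\<inverse>) = {}"
    using T by (auto simp: P_def J_def X_def nbrs_def dest: dominates_sym)
  ultimately have "card (P \<union> Id_on ?V \<union> J \<union> (X \<union> X\<inverse>)) =
      card P + card (Id_on ?V) + card J + card (X \<union> X\<inverse>)"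
    using finX by (simp add: card_Un_disjoint)
  moreover have "card (P \<union> Id_on ?V \<union> J \<union> (X \<union> X\<inverse>)) \<le> card (?V \<times> ?V)"
    using IV S T by (intro card_mono) (auto simp: P_def J_def X_def nbrs_def)
  moreover have "card (Id_on ?V) = card ?V"
  proof -
    have "Id_on ?V = (\<lambda>x. (x, x)) ` ?V" by (auto simp: Id_on_def)
    then show ?thesis by (simp add: card_image inj_on_def)
  qed
  ultimately have "card P + card ?V + card J + card (X \<union> X\<inverse>) \<le> card ?V * card ?V"
    by (simp add: card_cartesian_product)
  then have "real (card P + card ?V + card J + card (X \<union> X\<inverse>)) \<le> real (card ?V * card ?V)"
    by (simp only: of_nat_le_iff)
  then show ?thesis
    using cU cX cP card_offdiagonal[OF fin(1)] by (simp add: J_def n_def r_def power2_eq_square algebra_simps)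
qed

text \<open>
  After eliminating \<open>D\<close>, the difference \<open>\<Phi>\<close> of the two sides is concave in \<open>t\<close>, so that it suffices
  to consider the ends of the interval \<open>s + 1 \<le> t \<le> n - r - s\<close>.
\<close>

lemma missing_arcs_ge:
  fixes a b r n s t D :: int
  assumes a: "a \<ge> 1" and r: "r \<ge> 1" and b: "b \<ge> a" "b \<ge> 1"
    and n: "n \<ge> (r + 1) * (r + 2) + 2 * a\<^sup>2 + 2 * a * (r + 2) - 1"
    and s: "s \<ge> 1" and st: "s + t \<le> n - r" and D: "D \<ge> 0" "b * s + D < a * t"
  shows "2 * n - 2 + r * (r - 1) \<le> 2 * t * (n - r - s - 1) - 2 * D - t * (t - 1)"
proof -
  define N K where "N = n - r" and "K = r * (r + 1)"
  \<comment> \<open>Integrality gives \<open>D \<le> a * t - b * s - 1\<close>, and substituting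
    this yields \<open>\<Phi>\<close>. Replacing n by N + r turns r (r - 1) + 2 r into
    \<open>K\<close>; half of the constant 4 comes from the 1.\<close>
  define \<Phi> where "\<Phi> t = 2 * t * (N - s - 1 - a) + 2 * b * s + 4 - t * (t - 1) - 2 * N - K" for t
  have N: "N \<ge> (r + 1) * (r + 1) + 2 * a * a + 2 * (a * r) + 4 * a"
    using n by (simp add: N_def algebra_simps power2_eq_square)
  have N': "N \<ge> r * r + 2 * r + 1 + 2 * (a * a) + 2 * (a * r) + 4 * a"
    using N by (simp add: algebra_simps)
  have K: "K = r * r + r" by (simp add: K_def algebra_simps)
  have ar: "a * r \<ge> r" "a * a \<ge> a" "r * r \<ge> r" using a r by simp_all
  have "a * s \<le> b * s" using b s by (intro mult_right_mono) auto
  then have "a * s < a * t" using D by linarith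
  then have ts: "s + 1 \<le> t" using a by simp
  have Ns: "2 * s + 1 \<le> N" "t \<le> N - s" using ts st by (auto simp: N_def)
  have N12: "N \<ge> 12" using N' ar a r by linarith
  have \<Phi>0: "\<Phi> (s + 1) \<ge> 0"
  proof -
    \<comment> \<open>The first bracket is the value at s = 1, b = a.\<close>
    have eq: "\<Phi> (s + 1) = (2 * N - 6 - 2 * a - K) + (s - 1) * (2 * N - 3 * s - 8) + 2 * (b * s - a * s)"
      by (simp add: \<Phi>_def algebra_simps)
    have "2 * N - 6 - 2 * a - K \<ge> 0" using N' K ar a r by linarith
    \<comment> \<open>From N >= 2 s + 1 and N >= 12 follows 2 N >= 3 s + 15/2; integrality supplies
      the missing 1/2.\<close>
    moreover have "2 * N - 3 * s - 8 \<ge> 0" using Ns(1) N12 by presburger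
    then have "(s - 1) * (2 * N - 3 * s - 8) \<ge> 0" using s by simp
    moreover have "2 * (b * s - a * s) \<ge> 0" using \<open>a * s \<le> b * s\<close> by simp
    ultimately show ?thesis unfolding eq by (intro add_nonneg_nonneg)
  qed
  have \<Phi>1: "\<Phi> (N - s) \<ge> 0"
  proof -
    let ?t = "N - s"
    have eq: "\<Phi> ?t = ?t * (?t - 3 - 2 * a) + 2 * (b - 1) * s + 4 - K" by (simp add: \<Phi>_def algebra_simps)
    have bs: "2 * (b - 1) * s \<ge> 0" using b s by simp
    have t2: "2 * ?t \<ge> N + 1" using Ns by simp
    have "r * r + 2 * r + 2 * (a * a) + 2 * (a * r) \<ge> 7" using ar a r by linarith
    with N' have "N \<ge> 8 + 4 * a" by linarith
    with t2 have "?t - 3 - 2 * a \<ge> 2" by presburger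
    then have tt: "?t * 2 \<le> ?t * (?t - 3 - 2 * a)" using ts Ns s by (intro mult_left_mono) auto
    have "K \<le> 2 * ?t" using t2 N' K ar a r by linarith
    with tt bs show ?thesis unfolding eq by linarith
  qed
  have "\<Phi> t \<ge> 0"
  \<comment> \<open>\<open>\<Phi>\<close> has leading coefficient -1, so differences of its values
    factor. The case distinction asks on which side of the vertex of the parabola the midpoint of t
    and s + 1 lies, and so which end to compare with.\<close>
  proof (cases "t + (s + 1) \<le> 2 * (N - s - 1 - a) + 1")
    case True
    have "\<Phi> t = \<Phi> (s + 1) + (t - (s + 1)) * (2 * (N - s - 1 - a) + 1 - (t + (s + 1)))"
      by (simp add: \<Phi>_def algebra_simps)
    moreover have "(t - (s + 1)) * (2 * (N - s - 1 - a) + 1 - (t + (s + 1))) \<ge> 0"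
      using True ts by (intro mult_nonneg_nonneg) auto
    ultimately show ?thesis using \<Phi>0 by linarith
  next
    case False
    have "\<Phi> t = \<Phi> (N - s) + (N - s - t) * (t + (N - s) - 1 - 2 * (N - s - 1 - a))"
      by (simp add: \<Phi>_def algebra_simps)
    moreover have "(N - s - t) * (t + (N - s) - 1 - 2 * (N - s - 1 - a)) \<ge> 0"
      using False ts Ns by (intro mult_nonneg_nonneg) auto
    ultimately show ?thesis using \<Phi>1 by linarith
  qed
  then show ?thesis using D by (simp add: \<Phi>_def N_def K_def algebra_simps)
qed

text \<open>The upper bound on \<open>q\<close> makes the left side of \<open>L\<close> nonnegative,
  so squaring keeps the inequality; then q^2 is dropped and m (m - 1) is bounded by m^2. It is
  applied with m = n - 1 and q = r (r - 1).\<close>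

lemma square_ge_if_scaled_ge:
  fixes L m q :: real
  assumes m: "m > 0" and q: "0 \<le> q" "q \<le> m * (m - 1)" and L: "m * (m - 1) - q \<le> L * m"
  shows "(m - 1)\<^sup>2 - 2 * q \<le> L\<^sup>2"
proof -
  have "m\<^sup>2 * ((m - 1)\<^sup>2 - 2 * q) \<le> (m * (m - 1) - q)\<^sup>2"
    using m q by (simp add: power2_eq_square algebra_simps)
  also have "\<dots> \<le> (L * m)\<^sup>2" using L q by (intro power_mono) auto
  finally have "m\<^sup>2 * ((m - 1)\<^sup>2 - 2 * q) \<le> m\<^sup>2 * L\<^sup>2" by (simp add: power_mult_distrib mult.commute)
  then show ?thesis using m by simp
qed

section \<open>The two cases of the obstruction: \<open>S\<close> empty and \<open>S\<close>
  nonempty\<close>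

theorem theorem1p7:
  fixes G :: "('v, 'e) pre_digraph" and a b r n :: nat
  assumes "a \<ge> 1" and "r \<ge> 1" and "b \<ge> max a (2 * r + 2)"
    and "graph G" and "Digraph_Component.connected G" and "card (verts G) = n"
    and "int n \<ge> (int r + 1) * (int b - int r) + 2 * (int a)^2 + 2 * int a * (int r + 2) - 1"
    and "largest_eigenvalue G \<ge> largest_eigenvalue (with_proj (H_graph n a r))"
    and "\<not> digraph_iso G (with_proj (H_graph n a r))"
  shows "fractional_ID_factor_critical r a b G"
proof (rule ccontr)
  assume "\<not> fractional_ID_factor_critical r a b G"
  then obtain I where I: "independent_set G I" "card I = r"
    and no: "\<not> has_fractional_factor a b (G \<restriction> (verts G - I))"
    unfolding fractional_ID_factor_critical_def by blast
  interpret graph G by fact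
  let ?V = "verts G" and ?H = "with_proj (H_graph n a r)"
  have IV: "I \<subseteq> ?V" using I(1) by (simp add: independent_set_def)
  have finI: "finite I" by (rule finite_subset[OF IV]) simp
  have ab: "a \<le> b" and b: "int b - int r \<ge> int r + 2" using assms(3) by auto
  \<comment> \<open>Here b >= 2 r + 2 enters: the order bound is weakened to one free of b, as in
    \<open>missing_arcs_ge\<close>.\<close>
  have "(int r + 1) * (int r + 2) \<le> (int r + 1) * (int b - int r)"
    using b by (intro mult_left_mono) auto
  then have nn: "(int r + 1) * (int r + 2) + 2 * (int a)\<^sup>2 + 2 * int a * (int r + 2) - 1 \<le> int n"
    using assms(7) by linarith
  have n: "n \<ge> a + r" "n \<ge> 2" and nr: "r * (r - 1) \<le> (n - 1) * (n - 2)"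
  proof -
    have "int r * int r \<ge> 0" "int a * int a \<ge> 0" "int a * int r \<ge> 0" by simp_all
    moreover have "(int r + 1) * (int r + 2) + 2 * (int a)\<^sup>2 + 2 * int a * (int r + 2) - 1 =
        int r * int r + 3 * int r + 2 + 2 * (int a * int a) + 2 * (int a * int r) + 4 * int a - 1"
      by (simp add: algebra_simps power2_eq_square)
    ultimately have "int n \<ge> 3 * int r + 1 + 4 * int a" using nn by linarith
    then have *: "n \<ge> 3 * r + 1 + 4 * a" by linarith
    then show "n \<ge> a + r" "n \<ge> 2" using assms(1) by linarith+
    show "r * (r - 1) \<le> (n - 1) * (n - 2)" using * assms(1) by (intro mult_le_mono) linarith+
  qed
  have ne: "?V \<noteq> {}" using assms(6) n(2) by auto
  obtain S T where S: "S \<subseteq> ?V - I" and T: "T \<subseteq> ?V - I" and ST: "S \<inter> T = {}"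
    and obs: "b * card S + (\<Sum>v\<in>T. card (nbrs (G \<restriction> (?V - I)) v - S)) < a * card T"
    using no_fractional_factor_obstruction[OF graph_induce_subgraph[OF assms(4)] ab no] by auto
  have "nbrs (G \<restriction> (?V - I)) v - S = nbrs G v - I - S" if "v \<in> T" for v
    using that T by (subst nbrs_induce_subgraph[OF assms(4)]) (auto simp: nbrs_def)
  then have obs': "b * card S + (\<Sum>v\<in>T. card (nbrs G v - I - S)) < a * card T" using obs by simp
  have finST: "finite S" "finite T" using finite_subset[OF S] finite_subset[OF T] by simp_all
  show False
  proof (cases "S = {}")
    case True
    \<comment> \<open>With \<open>S\<close> empty, the obstruction says that the average degree over
      \<open>T\<close> in \<open>G - I\<close> is below a.\<close>
    have "\<exists>v\<in>T. card (nbrs G v - I) < a"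
    proof (rule ccontr)
      assume "\<not> ?thesis"
      then have "card T * a \<le> (\<Sum>v\<in>T. card (nbrs G v - I))"
        using sum_bounded_below[of T a "\<lambda>v. card (nbrs G v - I)"] by force
      then show False using obs' True by (simp add: mult.commute)
    qed
    then obtain v where v: "v \<in> ?V - I" "card (nbrs G v - I) < a" using T by blast
    obtain \<phi> where \<phi>: "bij_betw \<phi> ?V (pverts (H_graph n a r))"
      and hom: "\<And>u w. u \<rightarrow>\<^bsub>G\<^esub> w \<Longrightarrow> (\<phi> u, \<phi> w) \<in> parcs (H_graph n a r)"
      using H_graph_embedding[OF assms(4) I v assms(6) n(1)] by blast
    show False
    \<comment> \<open>Either H has an arc that \<open>G\<close> lacks, and strict comparison
      contradicts the eigenvalue hypothesis, or \<open>\<phi>\<close> is an isomorphism.\<close>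
    proof (cases "\<exists>x\<in>?V. \<exists>y\<in>?V. (\<phi> x, \<phi> y) \<in> parcs (H_graph n a r) \<and> \<not> x \<rightarrow>\<^bsub>G\<^esub> y")
      case True
      then obtain x y where "x \<in> ?V" "y \<in> ?V" "\<phi> x \<rightarrow>\<^bsub>?H\<^esub> \<phi> y" "\<not> x \<rightarrow>\<^bsub>G\<^esub> y" by auto
      then have "\<lambda>\<^sub>1 G < \<lambda>\<^sub>1 ?H"
        using \<phi> hom by (intro largest_eigenvalue_less[OF assms(4,5) ne graph_H_graph]) auto
      with assms(8) show False by simp
    next
      case False
      then have "digraph_iso G ?H"
        using hom by (intro digraph_iso_with_projI[OF assms(4) graph_H_graph \<phi>]) blast
      with assms(9) show False by simp
    qed
  next
    case False
    let ?deg = "\<Sum>v\<in>?V. real (card (nbrs G v))"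
    define D where "D = (\<Sum>v\<in>T. card (nbrs G v - I - S))"
    have deg: "?deg + real n + real r * (real r - 1)
        + 2 * real (card T) * (real n - real r - real (card S) - 1)
        \<le> (real n)\<^sup>2 + 2 * real D + real (card T) * (real (card T) - 1)"
      using sum_degrees_le[OF assms(4) I(1) S T ST] assms(6) I(2) by (simp add: D_def)
    have "card S + card T \<le> n - r"
      using card_mono[of "?V - I" "S \<union> T"] S T ST finST IV finI I(2) assms(6)
      by (simp add: card_Un_disjoint card_Diff_subset)
    then have "int (card S) + int (card T) \<le> int n - int r" using n(1) by linarith
    moreover have "int (b * card S + D) < int (a * card T)"
      unfolding of_nat_less_iff using obs' by (simp add: D_def)
    then have "int b * int (card S) + int D < int a * int (card T)" by simp
    moreover have "int (card S) \<ge> 1" using False finST by (simp add: Suc_le_eq card_gt_0_iff)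
    ultimately have "2 * int n - 2 + int r * (int r - 1) \<le>
        2 * int (card T) * (int n - int r - int (card S) - 1) - 2 * int D
          - int (card T) * (int (card T) - 1)"
      using nn assms(1-3) by (intro missing_arcs_ge) auto
    then have "real_of_int (2 * int n - 2 + int r * (int r - 1)) \<le>
        real_of_int (2 * int (card T) * (int n - int r - int (card S) - 1) - 2 * int D
          - int (card T) * (int (card T) - 1))" by (simp only: of_int_le_iff)
    then have miss: "2 * real n - 2 + real r * (real r - 1) \<le>
        2 * real (card T) * (real n - real r - real (card S) - 1) - 2 * real D
          - real (card T) * (real (card T) - 1)" by simp
    have hong: "(\<lambda>\<^sub>1 G)\<^sup>2 \<le> ?deg - real n + 1"
      using largest_eigenvalue_squared_le[OF assms(4) ne]
        nbrs_nonempty_if_connected[OF assms(5)] assms(6) n(2) by simp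
    have "\<lambda>\<^sub>1 ?H * (real n - 1) \<le> \<lambda>\<^sub>1 G * (real n - 1)"
      using assms(8) n(2) by (intro mult_right_mono) auto
    with largest_eigenvalue_H_graph_ge[OF assms(1) n(1)]
    have L: "(real n - 1) * (real n - 1 - 1) - real r * (real r - 1) \<le> \<lambda>\<^sub>1 G * (real n - 1)"
      by simp
    have "real (r * (r - 1)) \<le> real ((n - 1) * (n - 2))" using nr by (simp only: of_nat_le_iff)
    then have q: "real r * (real r - 1) \<le> (real n - 1) * (real n - 1 - 1)"
      using assms(2) n(2) by (simp add: of_nat_diff)
    \<comment> \<open>The lower bound is n^2 - 4 n + 4 - 2 r (r - 1), whereas \<open>hong\<close>,
      \<open>deg\<close> and \<open>miss\<close> together give at most n^2 - 4 n + 3 - 2 r (r - 1):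
      a contradiction by exactly 1.\<close>
    have "(real n - 1 - 1)\<^sup>2 - 2 * (real r * (real r - 1)) \<le> (\<lambda>\<^sub>1 G)\<^sup>2"
      by (rule square_ge_if_scaled_ge[OF _ _ q L]) (use n(2) assms(2) in auto)
    moreover have "(real n - 1 - 1)\<^sup>2 = (real n)\<^sup>2 - 4 * real n + 4"
      by (simp add: power2_eq_square algebra_simps)
    ultimately show False using hong deg miss by linarith
  qed
qed

end
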